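(* Let $\alpha\in\mathbb{S}^1$ be a Liouville number, let $(\alpha_n)$, $\alpha_n=\frac{p_n}{q_n}$, and the associated maps $H_{\mathbf{a},n}$ be as in the context, and for $\mathbf{a}\in\{0,1\}^{\mathbb{N}}$ let $H_{\mathbf{a}}=\lim_{n\to\infty}H_{\mathbf{a},n}$. Then for every $\mathbf{a}\in\{0,1\}^{\mathbb{N}}$ the homeomorphism $H_{\mathbf{a}}$ is singular.
   Context: $\mathbb{S}^1=\mathbb{R}/\mathbb{Z}$, $R_\alpha(x)=x+\alpha\bmod1$, $m$ is Lebesgue measure on $\mathbb{S}^1$. An irrational $\alpha$ is Liouville if for every $C>0$ and $n\in\mathbb{N}$ there are infinitely many pairs $p\in\mathbb{Z}$, $q\in\mathbb{N}$ with $0<|\alpha-p/q|<C/q^n$. $\|f\|_k=\max_{0\le i\le k}\max_x|D^if(x)|$, $d_k(f,g)=\max\{\|f-g\|_k,\|f^{-1}-g^{-1}\|_k\}$ (order-zero term measured by distance on the circle). Convergence in the $\mathrm{Diff}^\infty$-topology means convergence in $d_k$ for every $k\in\mathbb{N}$. $\mathcal{H}^\infty_\alpha$ is the set of orientation-preserving $C^\infty$ circle diffeomorphisms with rotation number $\alpha$. Construction: Fix a $C^\infty$ function $\psi:\mathbb{R}\to[0,1]$ with $\psi=0$ on $(-\infty,0]$, $\psi=1$ on $[1,\infty)$, strictly increasing on $[0,1]$. For $0<t<1/10$ put $A(x)=t(x-\frac14)+3t$, $B(x)=t^{-1}(x-\frac12)+\frac12$, $A'(x)=t(x-\frac34)+1-3t$,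 and let $\hat h_t:[0,1]\to[0,1]$ be the strictly increasing $C^\infty$ diffeomorphism equal to: $x$ on $[0,t]$; $(1-\psi(s))x+\psi(s)A(x)$ with $s=t^{-1}(x-t)$ on $[t,2t]$; $A(x)$ on $[2t,\frac{1-t+8t^2}{2}]$; $(1-\psi(s))A(x)+\psi(s)B(x)$ with $s=t^{-2}(x-\frac{1-t+8t^2}{2})$ on $[\frac{1-t+8t^2}{2},\frac{1-t+10t^2}{2}]$; $B(x)$ on $[\frac{1-t+10t^2}{2},\frac{1+t-10t^2}{2}]$; $(1-\psi(s))B(x)+\psi(s)A'(x)$ with $s=t^{-2}(x-\frac{1+t-10t^2}{2})$ on $[\frac{1+t-10t^2}{2},\frac{1+t-8t^2}{2}]$; $A'(x)$ on $[\frac{1+t-8t^2}{2},1-2t]$; $(1-\psi(s))A'(x)+\psi(s)x$ with $s=t^{-1}(x-1+2t)$ on $[1-2t,1-t]$; $x$ on $[1-t,1]$. Given positive integers $q_n$ (large enough that $t_n<1/10$), let $t_n=q_n^{1-2n}$, and let $h_{q_n}$ be the lift of the circle diffeomorphism $\hat h_{t_n}$ by the $q_n$-fold covering $x\mapsto q_nx$ having a fixed point, i.e. $h_{q_n}(x)=\frac{1}{q_n}(\ell+\hat h_{t_n}(q_nx-\ell))$ for $x\in[\frac{\ell}{q_n},\frac{\ell+1}{q_n}]$, $0\le\ell<q_n$. For $\mathbf{a}=(a_n)\in\{0,1\}^{\mathbb{N}}$ let $h_{\mathbf{a},n}=h_{q_n}$ if $a_n=0$ and $h_{\mathbf{a},n}=h_{q_n}^{-1}$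 if $a_n=1$; let $H_{\mathbf{a},0}=\mathrm{id}$ and $H_{\mathbf{a},n}=H_{\mathbf{a},n-1}\circ h_{\mathbf{a},n}$. Standing assumption: the rationals $\alpha_n=p_n/q_n$ are chosen so that $|\alpha-\alpha_n|\to0$ monotonically, $q_{n+1}\ge q_n^{2n}$ for all $n\in\mathbb N$, and for every $\mathbf{a}$ both $H_{\mathbf{a},n}\circ R_{\alpha_{n+1}}\circ H_{\mathbf{a},n}^{-1}$ and $H_{\mathbf{a},n}\circ R_{\alpha}\circ H_{\mathbf{a},n}^{-1}$ converge in the $\mathrm{Diff}^\infty$-topology to the same diffeomorphism $T_{\mathbf{a}}\in\mathcal{H}^\infty_\alpha$. Then $H_{\mathbf{a},n}$ converges in $d_0$ to a homeomorphism $H_{\mathbf{a}}$ with $H_{\mathbf{a}}(0)=0$ and $T_{\mathbf{a}}=H_{\mathbf{a}}\circ R_\alpha\circ H_{\mathbf{a}}^{-1}$, and the unique $T_{\mathbf{a}}$-invariant Borel probability measure is $\mu_{T_{\mathbf{a}}}=(H_{\mathbf{a}})_*m$. $H_{\mathbf{a}}$ is called singular if $\mu_{T_{\mathbf{a}}}$ is singular with respect to $m$ (equivalently, $H_{\mathbf a}$ maps some Lebesgue conull set to a null set / some null set to a conull set). *)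

theory Defs
  imports "HOL-Probability.Probability"
begin

section \<open>Circle maps\<close>

text \<open>
  The circle is \<open>\<real>/\<int>\<close>. Orientation-preserving circle homeomorphisms are represented by their
  lifts to the real line, which are determined up to an integer translation; all notions below
  are invariant under such translations. Points of the circle, for measure-theoretic purposes,
  are the elements of the fundamental domain \<open>[0,1)\<close>.
\<close>

definition circle_homeo :: "(real \<Rightarrow> real) \<Rightarrow> bool" where
  "circle_homeo F \<longleftrightarrow> continuous_on UNIV F \<and> strict_mono F \<and> (\<forall>x. F (x + 1) = F x + 1)"

definition C_infinity :: "(real \<Rightarrow> real) \<Rightarrow> bool" where
  "C_infinity f \<longleftrightarrow> (\<forall>k x. (deriv ^^ k) f differentiable at x)"

definition circle_diffeo :: "(real \<Rightarrow> real) \<Rightarrow> bool" where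
  "circle_diffeo F \<longleftrightarrow> circle_homeo F \<and> C_infinity F \<and> C_infinity (inv F)"

definition rotation :: "real \<Rightarrow> real \<Rightarrow> real" where
  "rotation \<alpha> x = x + \<alpha>"

definition conj_rotation :: "(real \<Rightarrow> real) \<Rightarrow> real \<Rightarrow> real \<Rightarrow> real" where
  "conj_rotation H \<beta> = H \<circ> rotation \<beta> \<circ> inv H"

text \<open>The translation number of a lift is defined over the reals, the rotation number modulo 1.\<close>

definition has_rotation_number :: "(real \<Rightarrow> real) \<Rightarrow> real \<Rightarrow> bool" where
  "has_rotation_number F \<alpha> \<longleftrightarrow>
     (\<exists>c. (\<forall>x. (\<lambda>n. (F ^^ n) x / real n) \<longlonglongrightarrow> c) \<and> c - \<alpha> \<in> \<int>)"

definition H_infinity :: "real \<Rightarrow> (real \<Rightarrow> real) set" where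
  "H_infinity \<alpha> = {F. circle_diffeo F \<and> has_rotation_number F \<alpha>}"

definition circle_dist :: "real \<Rightarrow> real \<Rightarrow> real" where
  "circle_dist x y = infdist (x - y) \<int>"

definition sup_diff :: "nat \<Rightarrow> (real \<Rightarrow> real) \<Rightarrow> (real \<Rightarrow> real) \<Rightarrow> real" where
  "sup_diff i f g =
     (if i = 0 then (SUP x. circle_dist (f x) (g x))
      else (SUP x. \<bar>(deriv ^^ i) f x - (deriv ^^ i) g x\<bar>))"

text \<open>
  For lifts of diffeomorphisms the functions under the suprema are continuous and 1-periodic,
  so the suprema are maxima over the circle.
\<close>

definition Ck_diff :: "nat \<Rightarrow> (real \<Rightarrow> real) \<Rightarrow> (real \<Rightarrow> real) \<Rightarrow> real" where
  "Ck_diff k f g = Max ((\<lambda>i. sup_diff i f g) ` {0..k})"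

definition Ck_dist :: "nat \<Rightarrow> (real \<Rightarrow> real) \<Rightarrow> (real \<Rightarrow> real) \<Rightarrow> real" where
  "Ck_dist k f g = max (Ck_diff k f g) (Ck_diff k (inv f) (inv g))"

definition converges_Ck :: "nat \<Rightarrow> (nat \<Rightarrow> real \<Rightarrow> real) \<Rightarrow> (real \<Rightarrow> real) \<Rightarrow> bool" where
  "converges_Ck k f g \<longleftrightarrow> (\<lambda>n. Ck_dist k (f n) g) \<longlonglongrightarrow> 0"

definition converges_Diff_infinity :: "(nat \<Rightarrow> real \<Rightarrow> real) \<Rightarrow> (real \<Rightarrow> real) \<Rightarrow> bool" where
  "converges_Diff_infinity f g \<longleftrightarrow> (\<forall>k. converges_Ck k f g)"

definition Liouville :: "real \<Rightarrow> bool" where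
  "Liouville \<alpha> \<longleftrightarrow> \<alpha> \<notin> \<rat> \<and>
     (\<forall>C>0. \<forall>n::nat. infinite {(p::int, q::nat). q > 0 \<and>
        0 < \<bar>\<alpha> - of_int p / real q\<bar> \<and> \<bar>\<alpha> - of_int p / real q\<bar> < C / real q ^ n})"


section \<open>Invariant measures and singularity\<close>

definition circle_lebesgue :: "real measure" where
  "circle_lebesgue = restrict_space lborel {0..<1}"

definition invariant_prob :: "(real \<Rightarrow> real) \<Rightarrow> real measure \<Rightarrow> bool" where
  "invariant_prob F \<mu> \<longleftrightarrow> sets \<mu> = sets circle_lebesgue \<and> prob_space \<mu> \<and>
     distr \<mu> \<mu> (\<lambda>x. frac (F x)) = \<mu>"

definition unique_invariant_prob :: "(real \<Rightarrow> real) \<Rightarrow> real measure \<Rightarrow> bool" where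
  "unique_invariant_prob F \<mu> \<longleftrightarrow>
     invariant_prob F \<mu> \<and> (\<forall>\<nu>. invariant_prob F \<nu> \<longrightarrow> \<nu> = \<mu>)"

definition mutually_singular :: "'a measure \<Rightarrow> 'a measure \<Rightarrow> bool" where
  "mutually_singular M N \<longleftrightarrow> sets M = sets N \<and>
     (\<exists>A\<in>sets M. emeasure M A = 0 \<and> emeasure N (space N - A) = 0)"

text \<open>
  A homeomorphism \<open>H\<close> is singular if the unique invariant Borel probability measure of
  \<open>T = H \<circ> R\<^sub>\<alpha> \<circ> H\<inverse>\<close> is singular with respect to Lebesgue measure.
\<close>

definition singular_homeo :: "real \<Rightarrow> (real \<Rightarrow> real) \<Rightarrow> bool" where
  "singular_homeo \<alpha> H \<longleftrightarrow>
     (\<exists>\<mu>. unique_invariant_prob (conj_rotation H \<alpha>) \<mu> \<and>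
          mutually_singular \<mu> circle_lebesgue)"


section \<open>The construction\<close>

definition cutoff :: "(real \<Rightarrow> real) \<Rightarrow> bool" where
  "cutoff \<psi> \<longleftrightarrow> C_infinity \<psi> \<and> range \<psi> \<subseteq> {0..1} \<and> (\<forall>x\<le>0. \<psi> x = 0) \<and> (\<forall>x\<ge>1. \<psi> x = 1) \<and>
     strict_mono_on {0..1} \<psi>"

definition A_map :: "real \<Rightarrow> real \<Rightarrow> real" where
  "A_map t x = t * (x - 1/4) + 3 * t"

definition B_map :: "real \<Rightarrow> real \<Rightarrow> real" where
  "B_map t x = (x - 1/2) / t + 1/2"

definition A'_map :: "real \<Rightarrow> real \<Rightarrow> real" where
  "A'_map t x = t * (x - 3/4) + 1 - 3 * t"

definition blend :: "(real \<Rightarrow> real) \<Rightarrow> real \<Rightarrow> real \<Rightarrow> real \<Rightarrow> real" where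
  "blend \<psi> s u v = (1 - \<psi> s) * u + \<psi> s * v"

text \<open>Only the values on \<open>[0,1]\<close> are used.\<close>

definition hat_h :: "(real \<Rightarrow> real) \<Rightarrow> real \<Rightarrow> real \<Rightarrow> real" where
  "hat_h \<psi> t x =
    (if x \<le> t then x
     else if x \<le> 2 * t then blend \<psi> ((x - t) / t) x (A_map t x)
     else if x \<le> (1 - t + 8 * t^2) / 2 then A_map t x
     else if x \<le> (1 - t + 10 * t^2) / 2
       then blend \<psi> ((x - (1 - t + 8 * t^2) / 2) / t^2) (A_map t x) (B_map t x)
     else if x \<le> (1 + t - 10 * t^2) / 2 then B_map t x
     else if x \<le> (1 + t - 8 * t^2) / 2
       then blend \<psi> ((x - (1 + t - 10 * t^2) / 2) / t^2) (B_map t x) (A'_map t x)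
     else if x \<le> 1 - 2 * t then A'_map t x
     else if x \<le> 1 - t then blend \<psi> ((x - 1 + 2 * t) / t) (A'_map t x) x
     else x)"

text \<open>With \<open>\<ell> = \<lfloor>q x\<rfloor>\<close> we have \<open>x \<in> [\<ell>/q, (\<ell>+1)/q)\<close> and \<open>frac (q x) = q x - \<ell>\<close>.\<close>

definition cover_h :: "(real \<Rightarrow> real) \<Rightarrow> nat \<Rightarrow> real \<Rightarrow> real \<Rightarrow> real" where
  "cover_h \<psi> q t x =
     (of_int \<lfloor>real q * x\<rfloor> + hat_h \<psi> t (frac (real q * x))) / real q"

definition t_seq :: "(nat \<Rightarrow> nat) \<Rightarrow> nat \<Rightarrow> real" where
  "t_seq q n = real (q n) powi (1 - 2 * int n)"

text \<open>
  In a 0-1 sequence \<open>a\<close>, \<open>False\<close> stands for 0 and \<open>True\<close> for 1. The sequences \<open>q\<close> and \<open>a\<close> are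
  indexed from 1; their values at 0 are irrelevant.
\<close>

definition h_map :: "(real \<Rightarrow> real) \<Rightarrow> (nat \<Rightarrow> nat) \<Rightarrow> (nat \<Rightarrow> bool) \<Rightarrow> nat \<Rightarrow> real \<Rightarrow> real" where
  "h_map \<psi> q a n =
     (let h = cover_h \<psi> (q n) (t_seq q n) in if a n then inv h else h)"

fun H_seq :: "(real \<Rightarrow> real) \<Rightarrow> (nat \<Rightarrow> nat) \<Rightarrow> (nat \<Rightarrow> bool) \<Rightarrow> nat \<Rightarrow> real \<Rightarrow> real" where
  "H_seq \<psi> q a 0 = id"
| "H_seq \<psi> q a (Suc n) = H_seq \<psi> q a n \<circ> h_map \<psi> q a (Suc n)"

end

theory Submission
  imports Defs
begin

text \<open>
  The block \<open>h = h\<^bsub>q\<^esub>\<close> or its inverse maps a \<open>q\<close>-periodic comb \<open>S\<close> of measure \<open>O(t)\<close> onto a set whose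
  complement has measure \<open>O(t)\<close>: either \<open>x\<close> lies in the comb of intervals of length \<open>t/q\<close> around the points
  \<open>(\<ell> + 1/2)/q\<close>, or \<open>h\<^bsub>q\<^esub> x\<close> lies in the comb of intervals of length \<open>8t/q\<close> around the points \<open>\<ell>/q\<close>, and
  the two combs exchange their roles for \<open>h\<^bsub>q\<^esub>\<inverse>\<close>.
  The Lipschitz constant of \<open>H\<^bsub>n-1\<^esub>\<close> is at most \<open>\<Prod>\<^bsub>j<n\<^esub> K/t\<^bsub>j\<^esub>\<close>, which by the growth of \<open>q\<close> is so much smaller
  than \<open>1/t\<^bsub>n\<^esub>\<close> that the complements of the sets \<open>H\<^bsub>n\<^esub> S\<^bsub>n\<^esub>\<close> have summable measure. On the other hand
  \<open>H\<inverse> \<circ> H\<^bsub>n\<^esub>\<close> moves points by \<open>O(1/q\<^bsub>n+1\<^esub>)\<close>, so \<open>H\<inverse> (H\<^bsub>n\<^esub> S\<^bsub>n\<^esub>)\<close> is contained in a slightly thickened comb and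
  has summable measure too. By Borel-Cantelli the limit superior of \<open>H\<^bsub>n\<^esub> S\<^bsub>n\<^esub>\<close> separates the push-forward of
  Lebesgue measure under \<open>H\<close> from Lebesgue measure.
\<close>

section \<open>Lifts of circle homeomorphisms\<close>

lemma equivariant_add_int:
  fixes F :: "real \<Rightarrow> real"
  assumes F: "\<forall>x. F (x + 1) = F x + 1"
  shows "F (x + of_int k) = F x + of_int k"
proof -
  have nat: "F (x + real n) = F x + real n" for n x
    by (induction n) (use F in \<open>auto simp: add.assoc [symmetric] add.commute [of 1]\<close>)
  show ?thesis
  proof (cases "k \<ge> 0")
    case True
    then show ?thesis using nat[of x "nat k"] by simp
  next
    case False
    then show ?thesis using nat[of "x + of_int k" "nat (- k)"] by simp
  qed
qed

text \<open>Reduction to \<open>frac x\<close>, where monotonicity squeezes \<open>F\<close> between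
  \<open>F 0\<close> and \<open>F 0 + 1\<close>. Uniformity in \<open>x\<close> is what later
  excludes a wrong translation constant.\<close>

lemma equivariant_bounded_displacement:
  fixes F :: "real \<Rightarrow> real"
  assumes "mono F" and F: "\<forall>x. F (x + 1) = F x + 1"
  shows "\<bar>F x - x - F 0\<bar> \<le> 1"
proof -
  have x: "x = frac x + of_int \<lfloor>x\<rfloor>"
    by (simp add: frac_def)
  have "F x = F (frac x) + of_int \<lfloor>x\<rfloor>"
    using equivariant_add_int[OF F, of "frac x" "\<lfloor>x\<rfloor>"] x by simp
  moreover have "F 0 \<le> F (frac x)" "F (frac x) \<le> F 0 + 1"
    using monoD[OF \<open>mono F\<close>, of 0 "frac x"] monoD[OF \<open>mono F\<close>, of "frac x" 1] F[rule_format, of 0]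
    by (auto simp: less_imp_le[OF frac_lt_1])
  ultimately show ?thesis
    using x frac_ge_0[of x] frac_lt_1[of x] by linarith
qed

lemma circle_homeo_bij:
  assumes "circle_homeo F"
  shows "bij F"
proof (rule bijI)
  from assms have c: "continuous_on UNIV F" and m: "strict_mono F" and F: "\<forall>x. F (x + 1) = F x + 1"
    by (auto simp: circle_homeo_def)
  show "inj F" by (rule strict_mono_imp_inj_on[OF m])
  show "surj F"
  proof (rule surjI)
    fix y
    define n where "n = \<lfloor>y - F 0\<rfloor>"
    have "F (of_int n) \<le> y" "y \<le> F (of_int n + 1)"
      using equivariant_add_int[OF F, of 0 n] F[rule_format, of "of_int n"] unfolding n_def
      by (simp_all, linarith+)
    then have "\<exists>x. of_int n \<le> x \<and> x \<le> of_int n + 1 \<and> F x = y"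
      by (intro IVT' continuous_on_subset[OF c]) auto
    then show "F (SOME x. F x = y) = y"
      by (metis (mono_tags, lifting) someI)
  qed
qed

lemma circle_homeo_inv:
  assumes "circle_homeo F"
  shows "strict_mono (inv F)" "inv F (x + 1) = inv F x + 1"
proof -
  from assms have m: "strict_mono F" and F: "\<forall>x. F (x + 1) = F x + 1"
    by (auto simp: circle_homeo_def)
  note b = circle_homeo_bij[OF assms]
  show "strict_mono (inv F)"
    by (rule strict_monoI)
       (metis b bij_inv_eq_iff m strict_mono_less)
  show "inv F (x + 1) = inv F x + 1"
    by (metis F b bij_inv_eq_iff)
qed

text \<open>Bounding increments from both sides by the same \<open>L\<close> makes the class stable
  under inversion without changing \<open>L\<close>, so a block and its inverse are treated alike.
  Fixing \<open>0\<close> selects one lift and makes \<open>[0,1]\<close> invariant.\<close>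

definition normal_lift :: "real \<Rightarrow> (real \<Rightarrow> real) \<Rightarrow> bool" where
  "normal_lift L f \<longleftrightarrow> L \<ge> 1 \<and> f 0 = 0 \<and> (\<forall>x. f (x + 1) = f x + 1) \<and>
     (\<forall>x y. x \<le> y \<longrightarrow> (y - x) / L \<le> f y - f x \<and> f y - f x \<le> L * (y - x))"

lemma normal_lift_circle_homeo:
  assumes "normal_lift L f"
  shows "circle_homeo f"
  unfolding circle_homeo_def
proof (intro conjI)
  note f = assms[unfolded normal_lift_def]
  show "strict_mono f"
  proof (rule strict_monoI)
    fix x y :: real assume "x < y"
    then have "(y - x) / L > 0" using f by simp
    then show "f x < f y" using f \<open>x < y\<close> by (smt (verit))
  qed
  have "L-lipschitz_on UNIV f"
  proof (rule lipschitz_onI)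
    fix x y
    show "dist (f x) (f y) \<le> L * dist x y"
    proof (induction x y rule: linorder_wlog)
      case (le x y)
      have "0 \<le> (y - x) / L" using f le by simp
      then show ?case using f le by (smt (verit) dist_real_def)
    qed (simp add: dist_commute)
  qed (use f in auto)
  then show "continuous_on UNIV f"
    by (rule lipschitz_on_continuous_on)
  show "\<forall>x. f (x + 1) = f x + 1"
    using f by blast
qed

lemma normal_lift_inv:
  assumes "normal_lift L f"
  shows "normal_lift L (inv f)"
proof -
  note f = assms[unfolded normal_lift_def]
  note h = normal_lift_circle_homeo[OF assms]
  note b = circle_homeo_bij[OF h]
  have [simp]: "f (inv f x) = x" for x
    using b by (simp add: bij_is_surj surj_f_inv_f)
  have "(y - x) / L \<le> inv f y - inv f x \<and> inv f y - inv f x \<le> L * (y - x)" if "x \<le> y" for x y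
  proof -
    have "inv f x \<le> inv f y"
      using circle_homeo_inv(1)[OF h] that by (simp add: strict_mono_less_eq)
    then have "(inv f y - inv f x) / L \<le> y - x" "y - x \<le> L * (inv f y - inv f x)"
      using f by (metis \<open>\<And>x. f (inv f x) = x\<close>)+
    then show ?thesis using f by (auto simp: field_simps)
  qed
  moreover have "inv f 0 = 0"
    using f b by (metis bij_inv_eq_iff)
  ultimately show ?thesis
    using f circle_homeo_inv(2)[OF h] by (auto simp: normal_lift_def)
qed

lemma normal_lift_compose:
  assumes f: "normal_lift L f" and g: "normal_lift M g"
  shows "normal_lift (L * M) (f \<circ> g)"
proof -
  note f' = f[unfolded normal_lift_def] and g' = g[unfolded normal_lift_def]
  have "(y - x) / (L * M) \<le> f (g y) - f (g x) \<and> f (g y) - f (g x) \<le> (L * M) * (y - x)"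
    if "x \<le> y" for x y
  proof -
    have g1: "(y - x) / M \<le> g y - g x" "g y - g x \<le> M * (y - x)"
      using g' that by auto
    have "0 \<le> (y - x) / M" using g' that by simp
    with g1 have "g x \<le> g y" by linarith
    then have f1: "(g y - g x) / L \<le> f (g y) - f (g x)" "f (g y) - f (g x) \<le> L * (g y - g x)"
      using f' by auto
    have "(y - x) / (L * M) \<le> (g y - g x) / L"
      using divide_right_mono[OF g1(1), of L] f' by (simp add: field_simps)
    moreover have "L * (g y - g x) \<le> L * (M * (y - x))"
      using g1(2) f' by (intro mult_left_mono) auto
    ultimately show ?thesis using f1 by (auto simp: mult.assoc)
  qed
  moreover have "1 \<le> L * M"
    using f' g' mult_mono[of 1 L 1 M] by simp
  ultimately show ?thesis
    using f' g' by (auto simp: normal_lift_def)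
qed

section \<open>Unique ergodicity\<close>

text \<open>The displacement \<open>\<Phi> x - x\<close> has the dense set \<open>\<int> + \<alpha>\<int>\<close> of periods; monotonicity of \<open>\<Phi>\<close>
  replaces continuity in concluding that it is constant.\<close>

lemma monotone_irrational_equivariant:
  fixes \<Phi> :: "real \<Rightarrow> real"
  assumes "\<alpha> \<notin> \<rat>" and m: "mono \<Phi>" and one: "\<forall>x. \<Phi> (x + 1) = \<Phi> x + 1"
    and al: "\<And>x. \<Phi> (x + \<alpha>) = \<Phi> x + c"
  shows "\<Phi> x = x + \<Phi> 0"
proof -
  have mult: "\<Phi> (x + real n * \<alpha>) = \<Phi> x + real n * c" for n x
  proof (induction n)
    case (Suc n)
    then show ?case using al[of "x + real n * \<alpha>"] by (simp add: algebra_simps)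
  qed simp
  \<comment> \<open>Otherwise the displacement after \<open>n\<close> translations by \<alpha>
    drifts by \<open>n * (c - \<alpha>)\<close>, which is unbounded.\<close>
  have "c = \<alpha>"
  proof (rule ccontr)
    assume "c \<noteq> \<alpha>"
    then obtain n :: nat where "real n * \<bar>c - \<alpha>\<bar> > 1"
      using reals_Archimedean3[of "\<bar>c - \<alpha>\<bar>"] by auto
    moreover have "\<bar>\<Phi> (real n * \<alpha>) - real n * \<alpha> - \<Phi> 0\<bar> \<le> 1"
      by (rule equivariant_bounded_displacement[OF m one])
    then have "\<bar>real n * (c - \<alpha>)\<bar> \<le> 1"
      using mult[of 0 n] by (simp add: algebra_simps)
    ultimately show False by (simp add: abs_mult)
  qed
  have le: "\<Phi> y - y \<le> \<Phi> x - x" for x y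
  proof (rule field_le_epsilon)
    fix e :: real assume "e > 0"
    \<comment> \<open>The target \<open>y - x + e/2\<close> with tolerance \<open>e/2\<close> places
      \<open>z\<close> in \<open>[y, y + e]\<close>, so comparing \<Phi> at \<open>y\<close> and
      \<open>z\<close> costs at most \<open>e\<close>.\<close>
    obtain k m where km: "k > 0" "\<bar>of_int k * \<alpha> - of_int m - (y - x + e/2)\<bar> < e/2"
      using sequence_of_fractional_parts_is_dense[OF \<open>\<alpha> \<notin> \<rat>\<close>, of "e/2" "y - x + e/2"] \<open>e > 0\<close>
      by (metis half_gt_zero)
    define z where "z = x + of_int k * \<alpha> + of_int (- m)"
    have "\<Phi> z = \<Phi> x + of_int k * \<alpha> - of_int m"
      using equivariant_add_int[OF one, of "x + of_int k * \<alpha>" "- m"] mult[of x "nat k"] km(1) \<open>c = \<alpha>\<close>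
      by (simp add: z_def)
    moreover have "y \<le> z" "z \<le> y + e"
      using km(2) unfolding z_def of_int_minus by linarith+
    ultimately show "\<Phi> y - y \<le> \<Phi> x - x + e"
      using monoD[OF m \<open>y \<le> z\<close>] by (simp add: z_def)
  qed
  show ?thesis
    using le[of x 0] le[of 0 x] by simp
qed

section \<open>Lebesgue measure on the fundamental domain and passage from lifts to the
  circle\<close>

lemma space_circle_lebesgue [simp]: "space circle_lebesgue = {0..<1}"
  by (simp add: circle_lebesgue_def space_restrict_space)

lemma emeasure_circle_lebesgue:
  "X \<subseteq> {0..<1} \<Longrightarrow> emeasure circle_lebesgue X = emeasure lborel X"
  by (simp add: circle_lebesgue_def emeasure_restrict_space)

lemma prob_space_circle_lebesgue: "prob_space circle_lebesgue"
  by (rule prob_spaceI) (simp add: circle_lebesgue_def emeasure_restrict_space space_restrict_space)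

lemma borel_measurable_circle:
  assumes "sets \<nu> = sets circle_lebesgue" "f \<in> borel_measurable borel"
  shows "f \<in> borel_measurable \<nu>"
  using assms by (auto simp: circle_lebesgue_def measurable_restrict_space1 cong: measurable_cong_sets)

lemma measurable_frac_circle:
  assumes \<nu>: "sets \<nu> = sets circle_lebesgue" "sets \<mu> = sets circle_lebesgue"
    and f: "f \<in> borel_measurable borel"
  shows "(\<lambda>x. frac (f x)) \<in> measurable \<nu> \<mu>"
proof -
  have "(\<lambda>x. frac (f x)) \<in> borel_measurable borel"
    unfolding frac_def using f by measurable
  then have "(\<lambda>x. frac (f x)) \<in> borel_measurable \<nu>"
    by (rule borel_measurable_circle[OF \<nu>(1)])
  then have "(\<lambda>x. frac (f x)) \<in> measurable \<nu> circle_lebesgue"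
    unfolding circle_lebesgue_def
    by (intro measurable_restrict_space2) (auto simp: frac_lt_1)
  then show ?thesis
    using \<nu>(2) by (simp cong: measurable_cong_sets)
qed

text \<open>Lets compositions of circle maps be computed on lifts, with a single reduction modulo 1
  at the end.\<close>

lemma frac_equivariant:
  fixes F :: "real \<Rightarrow> real"
  assumes "\<forall>x. F (x + 1) = F x + 1"
  shows "frac (F (frac x)) = frac (F x)"
proof -
  have "F x = F (frac x) + of_int \<lfloor>x\<rfloor>"
    using equivariant_add_int[OF assms, of "frac x" "\<lfloor>x\<rfloor>"] by (simp add: frac_def)
  then show ?thesis by (simp add: frac_def)
qed

text \<open>\<open>b \<le> w + n\<close> is equivalent to \<open>T b \<le> T w + n\<close>, and a
  ceiling is determined by the integers \<open>n\<close> above its argument. This carries a counting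
  function along with \<open>T\<close>.\<close>

lemma ceiling_equivariant_diff:
  fixes T :: "real \<Rightarrow> real"
  assumes "strict_mono T" "\<forall>x. T (x + 1) = T x + 1"
  shows "\<lceil>T b - T w\<rceil> = \<lceil>b - w\<rceil>"
proof -
  have "b - w \<le> of_int n \<longleftrightarrow> T b - T w \<le> of_int n" for n
  proof -
    have "b - w \<le> of_int n \<longleftrightarrow> T b \<le> T (w + of_int n)"
      using strict_mono_less_eq[OF assms(1)] by (simp add: algebra_simps)
    then show ?thesis
      using equivariant_add_int[OF assms(2)] by (simp add: algebra_simps)
  qed
  then have "\<lceil>b - w\<rceil> \<le> n \<longleftrightarrow> \<lceil>T b - T w\<rceil> \<le> n" for n
    by (simp add: ceiling_le_iff)
  then show ?thesis by (metis order_antisym order_refl)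
qed

lemma conj_rotation_lift:
  assumes "circle_homeo H"
  shows "strict_mono (conj_rotation H \<alpha>)"
    and "\<forall>x. conj_rotation H \<alpha> (x + 1) = conj_rotation H \<alpha> x + 1"
    and "conj_rotation H \<alpha> (H x) = H (x + \<alpha>)"
proof -
  note inv = circle_homeo_inv[OF assms]
  have H: "strict_mono H" "\<forall>x. H (x + 1) = H x + 1"
    using assms by (auto simp: circle_homeo_def)
  show "strict_mono (conj_rotation H \<alpha>)"
    by (rule strict_monoI)
       (use H(1) inv(1) in \<open>simp add: conj_rotation_def rotation_def strict_mono_less\<close>)
  show "\<forall>x. conj_rotation H \<alpha> (x + 1) = conj_rotation H \<alpha> x + 1"
  proof
    fix x
    show "conj_rotation H \<alpha> (x + 1) = conj_rotation H \<alpha> x + 1"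
      using H(2)[rule_format, of "inv H x + \<alpha>"]
      by (simp add: conj_rotation_def rotation_def inv(2) add.assoc add.commute[of 1])
  qed
  show "conj_rotation H \<alpha> (H x) = H (x + \<alpha>)"
    using circle_homeo_bij[OF assms] by (simp add: conj_rotation_def rotation_def bij_is_inj)
qed

text \<open>For \<open>w \<in> [0,1)\<close> the integer \<open>\<lceil>b - w\<rceil>\<close> counts with sign the translates of \<open>w\<close> between \<open>0\<close> and
  \<open>b\<close>. Hence \<open>F b = \<integral>\<lceil>b - w\<rceil> d\<nu>(w)\<close> is the distribution function of the periodic extension of
  \<open>\<nu>\<close>, and invariance of \<open>\<nu>\<close> says that \<open>F (T b) - F b\<close> is constant.\<close>

lemma invariant_measure_lessThan:
  assumes "\<alpha> \<notin> \<rat>" and H: "circle_homeo H" and inv: "invariant_prob (conj_rotation H \<alpha>) \<nu>"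
    and b: "0 \<le> b" "b \<le> 1"
  shows "measure \<nu> {0..<b} = inv H b - inv H 0"
proof -
  define T where "T = conj_rotation H \<alpha>"
  note T = conj_rotation_lift(1,2)[OF H, of \<alpha>, folded T_def]
  have sets: "sets \<nu> = sets circle_lebesgue" and d: "distr \<nu> \<nu> (\<lambda>x. frac (T x)) = \<nu>"
    using inv by (auto simp: invariant_prob_def T_def)
  interpret prob_space \<nu> using inv by (simp add: invariant_prob_def)
  have space: "space \<nu> = {0..<1}"
    using sets_eq_imp_space_eq[OF sets] by simp
  have Tm: "T \<in> borel_measurable borel"
    by (intro borel_measurable_mono strict_mono_mono T)
  note meas = borel_measurable_circle[OF sets]
  have cm: "(\<lambda>w. real_of_int \<lceil>c - w\<rceil>) \<in> borel_measurable \<nu>" for c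
    by (rule meas) measurable
  have int: "integrable \<nu> (\<lambda>w. real_of_int \<lceil>c - w\<rceil>)" for c
  proof (rule integrable_const_bound[where B = "\<bar>c\<bar> + 2"])
    show "AE w in \<nu>. norm (real_of_int \<lceil>c - w\<rceil>) \<le> \<bar>c\<bar> + 2"
    proof (rule AE_I2)
      fix w assume "w \<in> space \<nu>"
      then have "0 \<le> w" "w < 1" by (auto simp: space)
      then show "norm (real_of_int \<lceil>c - w\<rceil>) \<le> \<bar>c\<bar> + 2"
        unfolding real_norm_def by linarith
    qed
  qed (rule cm)
  have floor_int: "integrable \<nu> (\<lambda>w. real_of_int \<lfloor>T w\<rfloor>)"
  proof (rule integrable_const_bound[where B = "\<bar>T 0\<bar> + \<bar>T 1\<bar> + 1"])
    show "AE w in \<nu>. norm (real_of_int \<lfloor>T w\<rfloor>) \<le> \<bar>T 0\<bar> + \<bar>T 1\<bar> + 1"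
    proof (rule AE_I2)
      fix w assume "w \<in> space \<nu>"
      then have "T 0 \<le> T w" "T w < T 1"
        using T(1) by (auto simp: space strict_mono_less strict_mono_less_eq)
      then show "norm (real_of_int \<lfloor>T w\<rfloor>) \<le> \<bar>T 0\<bar> + \<bar>T 1\<bar> + 1"
        unfolding real_norm_def by linarith
    qed
    show "(\<lambda>w. real_of_int \<lfloor>T w\<rfloor>) \<in> borel_measurable \<nu>"
      using Tm by (intro meas) measurable
  qed
  define F where "F c = (\<integral>w. real_of_int \<lceil>c - w\<rceil> \<partial>\<nu>)" for c
  define k where "k = (\<integral>w. real_of_int \<lfloor>T w\<rfloor> \<partial>\<nu>)"
  \<comment> \<open>Invariance replaces \<open>w\<close> by \<open>frac (T w)\<close>. The floor
    that is split off does not depend on \<open>c\<close>, so it contributes only the constant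
    \<open>k\<close>.\<close>
  have FT: "F (T c) = F c + k" for c
  proof -
    have "F (T c) = (\<integral>w. real_of_int \<lceil>T c - w\<rceil> \<partial>(distr \<nu> \<nu> (\<lambda>x. frac (T x))))"
      by (simp add: F_def d)
    also have "\<dots> = (\<integral>w. real_of_int \<lceil>T c - frac (T w)\<rceil> \<partial>\<nu>)"
      by (intro integral_distr measurable_frac_circle sets Tm cm)
    also have "\<dots> = (\<integral>w. real_of_int \<lceil>c - w\<rceil> + real_of_int \<lfloor>T w\<rfloor> \<partial>\<nu>)"
    proof -
      have "\<lceil>T c - frac (T w)\<rceil> = \<lceil>c - w\<rceil> + \<lfloor>T w\<rfloor>" for w
      proof -
        have "T c - frac (T w) = (T c - T w) + of_int \<lfloor>T w\<rfloor>"
          by (simp add: frac_def)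
        then show ?thesis
          by (simp only: ceiling_add_of_int ceiling_equivariant_diff[OF T])
      qed
      then show ?thesis by simp
    qed
    also have "\<dots> = F c + k"
      unfolding F_def k_def by (intro Bochner_Integration.integral_add int floor_int)
    finally show ?thesis .
  qed
  have "mono F"
    unfolding F_def by (intro monoI integral_mono int) (auto intro!: ceiling_mono)
  have F1: "F (c + 1) = F c + 1" for c
  proof -
    have "\<lceil>c + 1 - w\<rceil> = \<lceil>c - w\<rceil> + 1" for w
      using ceiling_add_of_int[of "c - w" 1] by (simp add: algebra_simps)
    then have "F (c + 1) = (\<integral>w. real_of_int \<lceil>c - w\<rceil> + 1 \<partial>\<nu>)"
      by (simp add: F_def)
    then show ?thesis
      using Bochner_Integration.integral_add[OF int, of "\<lambda>_. 1" c] by (simp add: F_def prob_space)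
  qed
  have H': "mono H" "\<And>x. H (x + 1) = H x + 1"
    using H by (auto simp: circle_homeo_def strict_mono_mono)
  \<comment> \<open>\<open>H\<close> turns \<open>T\<close> into a rotation, so the rigidity of
    monotone equivariant maps applies to \<open>F \<circ> H\<close>. Monotonicity is all that is at
    hand for \<open>F\<close>, since atoms of \<nu> have not been excluded.\<close>
  have "(F \<circ> H) x = x + (F \<circ> H) 0" for x
  proof (rule monotone_irrational_equivariant[OF \<open>\<alpha> \<notin> \<rat>\<close>])
    show "mono (F \<circ> H)"
      using \<open>mono F\<close> H'(1) by (auto simp: mono_def)
    show "(F \<circ> H) (x + \<alpha>) = (F \<circ> H) x + k" for x
      using FT[of "H x"] conj_rotation_lift(3)[OF H, of \<alpha> x] by (simp add: T_def)
  qed (simp add: F1 H'(2))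
  from this[of "inv H y" for y] have F: "F y = inv H y + F (H 0)" for y
    unfolding o_apply surj_f_inv_f[OF bij_is_surj[OF circle_homeo_bij[OF H]]] .
  have "F c = measure \<nu> {0..<c}" if "0 \<le> c" "c \<le> 1" for c
  proof -
    have "F c = (\<integral>w. indicator {0..<c} w \<partial>\<nu>)"
      unfolding F_def
    proof (rule Bochner_Integration.integral_cong[OF refl])
      fix w assume "w \<in> space \<nu>"
      then have "0 \<le> w" "w < 1" by (auto simp: space)
      \<comment> \<open>Here \<open>c - w\<close> lies in \<open>(-1, 1]\<close>, and its ceiling is
        \<open>0\<close> at \<open>w = c\<close>, which matches the half-open interval.\<close>
      then have "\<lceil>c - w\<rceil> = (if w < c then 1 else 0)"
        using that by (auto simp: ceiling_eq_iff)
      then show "real_of_int \<lceil>c - w\<rceil> = indicator {0..<c} w"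
        using \<open>0 \<le> w\<close> by (simp add: indicator_def)
    qed
    also have "\<dots> = measure \<nu> ({0..<c} \<inter> space \<nu>)"
      by simp
    also have "{0..<c} \<inter> space \<nu> = {0..<c}"
      using that by (auto simp: space)
    finally show ?thesis .
  qed
  \<comment> \<open>Since \<open>F 0 = 0\<close>, the unknown constant \<open>F (H 0)\<close> equals
    \<open>- inv H 0\<close>.\<close>
  from this[of 0] this[OF b] show ?thesis
    using F[of 0] F[of b] by simp
qed

text \<open>Half-lines form a generating pi-system of the whole line, so both measures are first
  transported to \<open>borel\<close>; there a half-line meets \<open>[0,1)\<close> in an initial
  interval.\<close>

lemma circle_measure_eqI:
  assumes \<nu>: "sets \<nu> = sets circle_lebesgue" "prob_space \<nu>"
    and \<mu>: "sets \<mu> = sets circle_lebesgue" "prob_space \<mu>"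
    and eq: "\<And>b. 0 \<le> b \<Longrightarrow> b \<le> 1 \<Longrightarrow> measure \<nu> {0..<b} = measure \<mu> {0..<b}"
  shows "\<nu> = \<mu>"
proof -
  interpret \<nu>: prob_space \<nu> by fact
  interpret \<mu>: prob_space \<mu> by fact
  have sp: "space \<nu> = {0..<1}" "space \<mu> = {0..<1}"
    using sets_eq_imp_space_eq[OF \<nu>(1)] sets_eq_imp_space_eq[OF \<mu>(1)] by simp_all
  have m: "(\<lambda>x. x) \<in> borel_measurable \<nu>" "(\<lambda>x. x) \<in> borel_measurable \<mu>"
    by (rule borel_measurable_circle[OF \<nu>(1)] borel_measurable_circle[OF \<mu>(1)], simp)+
  have "distr \<nu> borel (\<lambda>x. x) = distr \<mu> borel (\<lambda>x. x)"
  proof (rule measure_eqI_generator_eq[where E = "range lessThan" and \<Omega> = UNIV and A = "\<lambda>i. {..<real i}"])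
    show "Int_stable (range lessThan :: real set set)"
    proof (rule Int_stableI)
      fix A B :: "real set" assume "A \<in> range lessThan" "B \<in> range lessThan"
      then obtain a b where "A = {..<a}" "B = {..<b}" by blast
      then have "A \<inter> B = {..<min a b}" by auto
      then show "A \<inter> B \<in> range lessThan" by simp
    qed
    fix X :: "real set" assume "X \<in> range lessThan"
    then obtain c where X: "X = {..<c}" by auto
    have *: "{..<c} \<inter> {0..<1} = {0..<max 0 (min c 1)}" by (auto simp: max_def)
    have "emeasure \<nu> {0..<max 0 (min c 1)} = emeasure \<mu> {0..<max 0 (min c 1)}"
      using eq[of "max 0 (min c 1)"] by (simp add: \<nu>.emeasure_eq_measure \<mu>.emeasure_eq_measure)
    then show "emeasure (distr \<nu> borel (\<lambda>x. x)) X = emeasure (distr \<mu> borel (\<lambda>x. x)) X"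
      by (simp add: X emeasure_distr m sp *)
  next
    show "(\<Union>i. {..<real i}) = UNIV"
      using reals_Archimedean2 by auto
    show "emeasure (distr \<nu> borel (\<lambda>x. x)) {..<real i} \<noteq> \<infinity>" for i
      using m by (simp add: emeasure_distr)
  qed (auto simp: borel_Iio)
  moreover have "emeasure (distr \<nu> borel (\<lambda>x. x)) A = emeasure \<nu> A"
    "emeasure (distr \<mu> borel (\<lambda>x. x)) A = emeasure \<mu> A" if "A \<in> sets circle_lebesgue" for A
  proof -
    have "A \<in> sets borel" "A \<subseteq> {0..<1}"
      using that by (auto simp: circle_lebesgue_def sets_restrict_space)
    then show "emeasure (distr \<nu> borel (\<lambda>x. x)) A = emeasure \<nu> A"
      "emeasure (distr \<mu> borel (\<lambda>x. x)) A = emeasure \<mu> A"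
      by (auto simp: emeasure_distr m sp Int_absorb2)
  qed
  ultimately show ?thesis
    using \<nu>(1) \<mu>(1) by (intro measure_eqI) auto
qed

text \<open>With \<open>\<beta> = frac \<alpha>\<close> the preimage of \<open>A\<close> consists of
  two translated pieces: the part of \<open>A\<close> in \<open>[\<beta>, 1)\<close> moved by
  \<open>- \<beta>\<close> and the part in \<open>[0, \<beta>)\<close> moved by
  \<open>1 - \<beta>\<close>. They are disjoint, and translations preserve length.\<close>

lemma distr_circle_lebesgue_rotation:
  "distr circle_lebesgue circle_lebesgue (\<lambda>x. frac (x + \<alpha>)) = circle_lebesgue"
proof (rule measure_eqI)
  fix A assume "A \<in> sets (distr circle_lebesgue circle_lebesgue (\<lambda>x. frac (x + \<alpha>)))"
  then have A: "A \<in> sets circle_lebesgue" by simp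
  then have [measurable]: "A \<in> sets borel" and sub: "A \<subseteq> {0..<1}"
    by (auto simp: circle_lebesgue_def sets_restrict_space)
  define \<beta> where "\<beta> = frac \<alpha>"
  have \<beta>: "0 \<le> \<beta>" "\<beta> < 1" by (auto simp: \<beta>_def frac_lt_1)
  have m: "(\<lambda>x. frac (x + \<alpha>)) \<in> measurable circle_lebesgue circle_lebesgue"
    by (intro measurable_frac_circle) auto
  have fr: "frac (x + \<alpha>) = (if x + \<beta> < 1 then x + \<beta> else x + \<beta> - 1)" if "0 \<le> x" "x < 1" for x
  proof -
    have "x = frac x" using that by (simp add: frac_eq)
    then show ?thesis
      using frac_add[of x \<alpha>] by (simp add: \<beta>_def)
  qed
  have shift: "emeasure lborel ((+) c -` B) = emeasure lborel B" if "B \<in> sets borel" for c :: real and B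
  proof -
    have "emeasure lborel B = emeasure (distr lborel borel ((+) c)) B"
      by (simp add: lborel_distr_plus)
    also have "\<dots> = emeasure lborel ((+) c -` B)"
      using that by (simp add: emeasure_distr)
    finally show ?thesis ..
  qed
  have vim: "(\<lambda>x. frac (x + \<alpha>)) -` A \<inter> {0..<1} = (+) \<beta> -` (A \<inter> {\<beta>..}) \<union> (+) (\<beta> - 1) -` (A \<inter> {..<\<beta>})"
    (is "_ = ?A \<union> ?B")
  proof (intro set_eqI iffI)
    fix x assume "x \<in> (\<lambda>x. frac (x + \<alpha>)) -` A \<inter> {0..<1}"
    then show "x \<in> ?A \<union> ?B"
      using fr[of x] by (auto split: if_splits simp: algebra_simps)
  next
    have A01: "0 \<le> y \<and> y < 1" if "y \<in> A" for y
      using sub that by auto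
    fix x assume "x \<in> ?A \<union> ?B"
    then consider "\<beta> + x \<in> A" "0 \<le> x" | "\<beta> - 1 + x \<in> A" "x < 1" by auto
    then show "x \<in> (\<lambda>x. frac (x + \<alpha>)) -` A \<inter> {0..<1}"
    proof cases
      case 1
      have "x + \<beta> < 1" using A01[OF 1(1)] by linarith
      moreover have "x < 1" using calculation \<beta> by linarith
      ultimately have "frac (x + \<alpha>) = \<beta> + x" using fr[of x] 1(2) by simp
      then show ?thesis using 1 \<open>x < 1\<close> by simp
    next
      case 2
      have "\<not> x + \<beta> < 1" using A01[OF 2(1)] by linarith
      moreover have "0 \<le> x" using calculation \<beta> by linarith
      ultimately have "frac (x + \<alpha>) = \<beta> - 1 + x" using fr[of x] 2(2) by simp
      then show ?thesis using 2 \<open>0 \<le> x\<close> by simp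
    qed
  qed
  have "emeasure (distr circle_lebesgue circle_lebesgue (\<lambda>x. frac (x + \<alpha>))) A =
      emeasure circle_lebesgue ((\<lambda>x. frac (x + \<alpha>)) -` A \<inter> {0..<1})"
    using m A by (simp add: emeasure_distr)
  also have "\<dots> = emeasure lborel ((\<lambda>x. frac (x + \<alpha>)) -` A \<inter> {0..<1})"
    by (rule emeasure_circle_lebesgue) simp
  also have "\<dots> = emeasure lborel (?A \<union> ?B)"
    by (simp only: vim)
  also have "\<dots> = emeasure lborel ?A + emeasure lborel ?B"
  proof (rule plus_emeasure [symmetric])
    have [measurable]: "(+) c \<in> borel_measurable borel" for c :: real by measurable
    show "?A \<in> sets lborel" "?B \<in> sets lborel"
      using measurable_sets[of "(+) \<beta>" borel borel "A \<inter> {\<beta>..}"]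
        measurable_sets[of "(+) (\<beta> - 1)" borel borel "A \<inter> {..<\<beta>}"] by simp_all
    show "?A \<inter> ?B = {}"
    proof (rule equals0I)
      fix x assume "x \<in> ?A \<inter> ?B"
      then have "\<beta> + x \<in> {0..<1}" "\<beta> - 1 + x \<in> {0..<1}" using sub by auto
      then show False by simp
    qed
  qed
  also have "\<dots> = emeasure lborel (A \<inter> {\<beta>..}) + emeasure lborel (A \<inter> {..<\<beta>})"
    by (intro arg_cong2[where f = plus] shift) auto
  also have "\<dots> = emeasure lborel (A \<inter> {\<beta>..} \<union> A \<inter> {..<\<beta>})"
    by (intro plus_emeasure) auto
  also have "A \<inter> {\<beta>..} \<union> A \<inter> {..<\<beta>} = A" by auto
  also have "emeasure lborel A = emeasure circle_lebesgue A"
    using sub by (simp add: emeasure_circle_lebesgue)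
  finally show "emeasure (distr circle_lebesgue circle_lebesgue (\<lambda>x. frac (x + \<alpha>))) A = emeasure circle_lebesgue A" .
qed simp

definition pushforward :: "(real \<Rightarrow> real) \<Rightarrow> real measure" where
  "pushforward H = distr circle_lebesgue circle_lebesgue (\<lambda>x. frac (H x))"

lemma circle_homeo_measurable:
  assumes "circle_homeo H"
  shows "H \<in> borel_measurable borel"
  using assms by (intro borel_measurable_mono) (simp add: circle_homeo_def strict_mono_mono)

text \<open>Invariance follows from \<open>T \<circ> H = H \<circ> R\<close> and the invariance of
  length under rotation. Uniqueness holds because the values of an invariant measure on initial
  intervals are determined by \<open>inv H\<close> alone.\<close>

lemma unique_invariant_pushforward:
  assumes "\<alpha> \<notin> \<rat>" and H: "circle_homeo H"
  shows "unique_invariant_prob (conj_rotation H \<alpha>) (pushforward H)"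
proof -
  note T = conj_rotation_lift[OF H, of \<alpha>]
  have H': "\<forall>x. H (x + 1) = H x + 1"
    using H by (auto simp: circle_homeo_def)
  have m: "(\<lambda>x. frac (H x)) \<in> measurable circle_lebesgue circle_lebesgue"
    by (intro measurable_frac_circle circle_homeo_measurable H refl)
  have mT: "(\<lambda>x. frac (conj_rotation H \<alpha> x)) \<in> measurable circle_lebesgue circle_lebesgue"
    by (intro measurable_frac_circle refl borel_measurable_mono strict_mono_mono T)
  have mR: "(\<lambda>x. frac (x + \<alpha>)) \<in> measurable circle_lebesgue circle_lebesgue"
    by (intro measurable_frac_circle) auto
  have "distr (pushforward H) (pushforward H) (\<lambda>x. frac (conj_rotation H \<alpha> x)) =
      distr (pushforward H) circle_lebesgue (\<lambda>x. frac (conj_rotation H \<alpha> x))"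
    by (intro distr_cong) (auto simp: pushforward_def)
  also have "\<dots> = distr circle_lebesgue circle_lebesgue
      ((\<lambda>x. frac (conj_rotation H \<alpha> x)) \<circ> (\<lambda>x. frac (H x)))"
    unfolding pushforward_def by (rule distr_distr[OF mT m])
  also have "(\<lambda>x. frac (conj_rotation H \<alpha> x)) \<circ> (\<lambda>x. frac (H x)) =
      (\<lambda>x. frac (H x)) \<circ> (\<lambda>x. frac (x + \<alpha>))"
    using frac_equivariant[OF T(2)] frac_equivariant[OF H'] T(3) by (auto simp: fun_eq_iff)
  also have "distr circle_lebesgue circle_lebesgue \<dots> =
      distr (distr circle_lebesgue circle_lebesgue (\<lambda>x. frac (x + \<alpha>))) circle_lebesgue (\<lambda>x. frac (H x))"
    by (rule distr_distr[OF m mR, symmetric])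
  also have "\<dots> = pushforward H"
    by (simp add: distr_circle_lebesgue_rotation pushforward_def)
  finally have d: "distr (pushforward H) (pushforward H) (\<lambda>x. frac (conj_rotation H \<alpha> x)) = pushforward H" .
  have "sets (pushforward H) = sets circle_lebesgue" "prob_space (pushforward H)"
    using prob_space.prob_space_distr[OF prob_space_circle_lebesgue m] by (simp_all add: pushforward_def)
  with d have inv: "invariant_prob (conj_rotation H \<alpha>) (pushforward H)"
    unfolding invariant_prob_def by blast
  moreover have "\<nu> = pushforward H" if "invariant_prob (conj_rotation H \<alpha>) \<nu>" for \<nu>
  proof (rule circle_measure_eqI)
    show "measure \<nu> {0..<b} = measure (pushforward H) {0..<b}" if "0 \<le> b" "b \<le> 1" for b
      using invariant_measure_lessThan[OF assms \<open>invariant_prob _ \<nu>\<close> that]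
        invariant_measure_lessThan[OF assms inv that] by simp
  qed (use that inv in \<open>auto simp only: invariant_prob_def\<close>)
  ultimately show ?thesis
    unfolding unique_invariant_prob_def by blast
qed

section \<open>Distortion of the building blocks\<close>

text \<open>Discrete form of the derivative bounds \<open>c \<le> f' \<le> C\<close>. Increments,
  unlike derivatives, can be joined at a common endpoint of two pieces without examining smoothness
  there.\<close>

definition incr_bounds :: "real \<Rightarrow> real \<Rightarrow> (real \<Rightarrow> real) \<Rightarrow> real \<Rightarrow> real \<Rightarrow> bool" where
  "incr_bounds c C f a b \<longleftrightarrow>
     (\<forall>x y. a \<le> x \<longrightarrow> x \<le> y \<longrightarrow> y \<le> b \<longrightarrow> c * (y - x) \<le> f y - f x \<and> f y - f x \<le> C * (y - x))"

lemma incr_bounds_join: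
  assumes "incr_bounds c C f a b" "incr_bounds c C f b d"
  shows "incr_bounds c C f a d"
  unfolding incr_bounds_def
proof (intro allI impI)
  fix x y assume xy: "a \<le> x" "x \<le> y" "y \<le> d"
  consider "y \<le> b" | "b \<le> x" | "x \<le> b" "b \<le> y" by linarith
  then show "c * (y - x) \<le> f y - f x \<and> f y - f x \<le> C * (y - x)"
  proof cases
    case 3
    then have "c * (b - x) \<le> f b - f x \<and> f b - f x \<le> C * (b - x)"
      "c * (y - b) \<le> f y - f b \<and> f y - f b \<le> C * (y - b)"
      using assms xy unfolding incr_bounds_def by auto
    then show ?thesis by (simp add: algebra_simps)
  qed (use assms xy in \<open>auto simp: incr_bounds_def\<close>)
qed

lemma incr_bounds_cong:
  assumes "\<And>x. a \<le> x \<Longrightarrow> x \<le> b \<Longrightarrow> f x = g x"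
  shows "incr_bounds c C f a b \<longleftrightarrow> incr_bounds c C g a b"
  unfolding incr_bounds_def using assms by (smt (verit))

lemma incr_bounds_affine:
  assumes "c \<le> s" "s \<le> C"
  shows "incr_bounds c C (\<lambda>x. s * (x - r) + k) a b"
  unfolding incr_bounds_def
proof (intro allI impI)
  fix x y :: real assume "x \<le> y"
  then have "c * (y - x) \<le> s * (y - x)" "s * (y - x) \<le> C * (y - x)"
    using assms by (auto intro: mult_right_mono)
  then show "c * (y - x) \<le> s * (y - r) + k - (s * (x - r) + k) \<and>
      s * (y - r) + k - (s * (x - r) + k) \<le> C * (y - x)"
    by (simp add: algebra_simps)
qed

lemma incr_bounds_weaken:
  assumes "incr_bounds c C f a b" "C \<le> D"
  shows "incr_bounds c D f a b"
  unfolding incr_bounds_def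
proof (intro allI impI)
  fix x y assume xy: "a \<le> x" "x \<le> y" "y \<le> b"
  then have "C * (y - x) \<le> D * (y - x)"
    using assms(2) by (intro mult_right_mono) auto
  then show "c * (y - x) \<le> f y - f x \<and> f y - f x \<le> D * (y - x)"
    using assms(1) xy unfolding incr_bounds_def by fastforce
qed

text \<open>Since \<open>v \<ge> u\<close>, the derivative of the cutoff contributes with a nonnegative sign, so a blend
  increases at least as fast as the slower of \<open>u\<close> and \<open>v\<close>.\<close>

lemma incr_bounds_blend:
  assumes u: "incr_bounds c C u a b" and v: "incr_bounds c C v a b"
    and \<psi>: "\<And>x. 0 \<le> \<psi> x \<and> \<psi> x \<le> 1" "\<And>x y. x \<le> y \<Longrightarrow> 0 \<le> \<psi> y - \<psi> x \<and> \<psi> y - \<psi> x \<le> M * (y - x)"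
    and uv: "\<And>x. a \<le> x \<Longrightarrow> x \<le> b \<Longrightarrow> 0 \<le> v x - u x \<and> v x - u x \<le> e * w"
    and w: "w > 0" and e: "M \<ge> 0"
  shows "incr_bounds c (C + M * e) (\<lambda>x. blend \<psi> ((x - r) / w) (u x) (v x)) a b"
  unfolding incr_bounds_def
proof (intro allI impI)
  fix x y assume xy: "a \<le> x" "x \<le> y" "y \<le> b"
  define p q where "p = \<psi> ((x - r) / w)" and "q = \<psi> ((y - r) / w)"
  have "(y - r) / w - (x - r) / w = (y - x) / w"
    by (simp add: diff_divide_distrib)
  then have pq: "0 \<le> q - p" "q - p \<le> M * ((y - x) / w)"
    using \<psi>(2)[of "(x - r) / w" "(y - r) / w"] xy(2) w
    unfolding p_def q_def by (auto simp: divide_right_mono)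
  have q: "0 \<le> q" "q \<le> 1" using \<psi>(1) by (auto simp: q_def)
  have U: "c * (y - x) \<le> u y - u x" "u y - u x \<le> C * (y - x)"
    and V: "c * (y - x) \<le> v y - v x" "v y - v x \<le> C * (y - x)"
    using u v xy unfolding incr_bounds_def by auto
  have W: "0 \<le> v x - u x" "v x - u x \<le> e * w" using uv xy by auto
  \<comment> \<open>Discrete product rule with the weights frozen at \<open>y\<close>: two terms
    form a convex combination of increments, and only the last one carries the increment of the
    cutoff.\<close>
  have eq: "blend \<psi> ((y - r) / w) (u y) (v y) - blend \<psi> ((x - r) / w) (u x) (v x) =
    (1 - q) * (u y - u x) + q * (v y - v x) + (q - p) * (v x - u x)"
    by (simp add: blend_def p_def q_def algebra_simps)
  have lower: "(1 - q) * (c * (y - x)) + q * (c * (y - x)) \<le> (1 - q) * (u y - u x) + q * (v y - v x)"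
    using U V q by (intro add_mono mult_left_mono) auto
  have upper: "(1 - q) * (u y - u x) + q * (v y - v x) \<le> (1 - q) * (C * (y - x)) + q * (C * (y - x))"
    using U V q by (intro add_mono mult_left_mono) auto
  \<comment> \<open>The window width cancels: the cutoff rescaled to width \<open>w\<close> has
    Lipschitz constant \<open>M / w\<close>, while the gap is at most \<open>e * w\<close>.\<close>
  have "(q - p) * (v x - u x) \<le> (M * ((y - x) / w)) * (e * w)"
    using pq W xy e w by (intro mult_mono) auto
  also have "\<dots> = M * e * (y - x)"
    using w by simp
  finally have "(q - p) * (v x - u x) \<le> M * e * (y - x)" .
  moreover have "0 \<le> (q - p) * (v x - u x)"
    using pq W by simp
  ultimately show "c * (y - x) \<le> blend \<psi> ((y - r) / w) (u y) (v y) - blend \<psi> ((x - r) / w) (u x) (v x) \<and>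
      blend \<psi> ((y - r) / w) (u y) (v y) - blend \<psi> ((x - r) / w) (u x) (v x) \<le> (C + M * e) * (y - x)"
    using lower upper unfolding eq by (simp add: algebra_simps)
qed

text \<open>The derivative is bounded on \<open>[0,1]\<close> by compactness and \<psi> is constant
  on either side. Clamping both arguments to \<open>[0,1]\<close> does not increase their distance
  and reduces the claim to the mean value theorem.\<close>

lemma cutoff_lipschitz:
  assumes "cutoff \<psi>"
  obtains M where "M \<ge> 0" "\<And>x y. x \<le> y \<Longrightarrow> 0 \<le> \<psi> y - \<psi> x \<and> \<psi> y - \<psi> x \<le> M * (y - x)"
proof -
  from assms have C: "C_infinity \<psi>" and z: "\<And>x. x \<le> 0 \<Longrightarrow> \<psi> x = 0" and o: "\<And>x. x \<ge> 1 \<Longrightarrow> \<psi> x = 1"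
    and m: "strict_mono_on {0..1} \<psi>"
    by (auto simp: cutoff_def)
  have d0: "(\<psi> has_real_derivative deriv \<psi> x) (at x)" for x
    using C[unfolded C_infinity_def, rule_format, of 0 x]
    by (simp add: DERIV_deriv_iff_real_differentiable)
  have "deriv \<psi> differentiable (at x)" for x
    using C[unfolded C_infinity_def, rule_format, of 1 x] by simp
  then have "continuous_on {0..1} (deriv \<psi>)"
    by (auto intro!: continuous_at_imp_continuous_on differentiable_imp_continuous_within)
  then have "bounded (deriv \<psi> ` {0..1})"
    by (intro compact_imp_bounded compact_continuous_image) auto
  then obtain M where M: "M > 0" "\<And>x. 0 \<le> x \<Longrightarrow> x \<le> 1 \<Longrightarrow> \<bar>deriv \<psi> x\<bar> \<le> M"
    by (auto simp: bounded_pos)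
  have "0 \<le> \<psi> y - \<psi> x \<and> \<psi> y - \<psi> x \<le> M * (y - x)" if "x \<le> y" for x y
  proof -
    define x' y' where "x' = max 0 (min 1 x)" and "y' = max 0 (min 1 y)"
    have r: "0 \<le> x'" "x' \<le> y'" "y' \<le> 1" "y' - x' \<le> y - x"
      using that by (auto simp: x'_def y'_def)
    have eq: "\<psi> x = \<psi> x'" "\<psi> y = \<psi> y'"
      using z[of x] z[of y] z[of 0] o[of x] o[of y] o[of 1] by (auto simp: x'_def y'_def max_def min_def)
    have "\<psi> x' \<le> \<psi> y'"
      using strict_mono_on_leD[OF m, of x' y'] r by auto
    moreover have "\<psi> y' - \<psi> x' \<le> M * (y' - x')"
    proof (cases "x' = y'")
      case False
      then obtain c where c: "x' < c" "c < y'" "\<psi> y' - \<psi> x' = (y' - x') * deriv \<psi> c"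
        using MVT2[of x' y' \<psi> "deriv \<psi>"] d0 r by force
      have "(y' - x') * deriv \<psi> c \<le> (y' - x') * M"
        using M(2)[of c] c(1,2) r by (intro mult_left_mono) auto
      then show ?thesis using c(3) by (simp add: mult.commute)
    qed simp
    moreover have "M * (y' - x') \<le> M * (y - x)"
      using r M(1) by (intro mult_left_mono) auto
    ultimately show ?thesis unfolding eq by linarith
  qed
  with M(1) show thesis by (intro that[of M]) auto
qed

text \<open>\<open>M\<close> belongs to the cutoff and not to \<open>t\<close>, so the distortion
  constant of a block will be a fixed number divided by \<open>t\<close>.\<close>

locale circle_block =
  fixes \<psi> :: "real \<Rightarrow> real" and M t :: real
  assumes \<psi>: "cutoff \<psi>" and M: "M \<ge> 0"
    and lip: "x \<le> y \<Longrightarrow> 0 \<le> \<psi> y - \<psi> x \<and> \<psi> y - \<psi> x \<le> M * (y - x)"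
    and t: "0 < t" "t < 1/10"
begin

lemma \<psi>_simps: "0 \<le> \<psi> x \<and> \<psi> x \<le> 1" "x \<le> 0 \<Longrightarrow> \<psi> x = 0" "x \<ge> 1 \<Longrightarrow> \<psi> x = 1"
  using \<psi> by (auto simp: cutoff_def subset_eq)

lemma blend_ends: "s = 0 \<Longrightarrow> blend \<psi> s u v = u" "s = 1 \<Longrightarrow> blend \<psi> s u v = v"
  by (simp_all add: blend_def \<psi>_simps)

lemma A_map_eq: "A_map t x = t * x + 11 / 4 * t"
  by (simp add: A_map_def algebra_simps)

lemma A'_map_eq: "A'_map t x = t * x + 1 - 15 / 4 * t"
  by (simp add: A'_map_def algebra_simps)

lemma t_sq: "t\<^sup>2 < t / 10" "t\<^sup>2 > 0"
  using t mult_strict_left_mono[of t "1/10" t] by (auto simp: power2_eq_square)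

text \<open>The slopes are \<open>1\<close>, \<open>t\<close>, \<open>1 / t\<close> and
  \<open>t\<close>, all in \<open>[t, 1 / t]\<close> because \<open>t < 1\<close>.\<close>

lemma incr_bounds_pieces:
  "incr_bounds t (1 / t) (\<lambda>x. x) a b" "incr_bounds t (1 / t) (A_map t) a b"
  "incr_bounds t (1 / t) (B_map t) a b" "incr_bounds t (1 / t) (A'_map t) a b"
proof -
  have le: "t \<le> 1" "1 \<le> 1 / t" "t \<le> 1 / t"
    using t mult_mono[of t 1 t 1] by (auto simp: field_simps)
  show "incr_bounds t (1 / t) (\<lambda>x. x) a b"
    using incr_bounds_affine[OF le(1,2), of 0 0 a b] by simp
  show "incr_bounds t (1 / t) (A_map t) a b"
    using incr_bounds_affine[of t t "1/t" "1/4" "3*t" a b] le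
    by (simp add: A_map_def[abs_def])
  show "incr_bounds t (1 / t) (B_map t) a b"
    using incr_bounds_affine[of t "1/t" "1/t" "1/2" "1/2" a b] le
    by (simp add: B_map_def[abs_def])
  show "incr_bounds t (1 / t) (A'_map t) a b"
    using incr_bounds_affine[of t t "1/t" "3/4" "1-3*t" a b] le
    by (simp add: A'_map_def[abs_def] algebra_simps)
qed

lemma incr_bounds_pieces':
  assumes "incr_bounds t (1 / t) f a b"
  shows "incr_bounds t ((1 + 3 * M) / t) f a b"
  using t M by (intro incr_bounds_weaken[OF assms]) (auto simp: field_simps)

text \<open>The number \<open>3\<close> serves all four transitions: the gap is at most
  \<open>3\<close> on the outer windows of width \<open>t\<close> and at most \<open>3 * t\<close>
  on the inner windows of width \<open>t^2\<close>.\<close>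

lemma incr_bounds_transition:
  assumes u: "incr_bounds t (1 / t) u a b" "incr_bounds t (1 / t) v a b"
    and "\<And>x. a \<le> x \<Longrightarrow> x \<le> b \<Longrightarrow> 0 \<le> v x - u x \<and> v x - u x \<le> 3 / t * w" and "w > 0"
  shows "incr_bounds t ((1 + 3 * M) / t) (\<lambda>x. blend \<psi> ((x - r) / w) (u x) (v x)) a b"
proof -
  have "incr_bounds t (1 / t + M * (3 / t)) (\<lambda>x. blend \<psi> ((x - r) / w) (u x) (v x)) a b"
    by (rule incr_bounds_blend[OF u _ _ assms(3,4) M]) (use lip \<psi>_simps(1) in auto)
  also have "1 / t + M * (3 / t) = (1 + 3 * M) / t"
    by (simp add: add_divide_distrib)
  finally show ?thesis .
qed

lemma breakpoints:
  "2 * t < (1 - t + 8 * t^2) / 2"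
  "(1 - t + 8 * t^2) / 2 < (1 - t + 10 * t^2) / 2"
  "(1 - t + 10 * t^2) / 2 < (1 + t - 10 * t^2) / 2"
  "(1 + t - 10 * t^2) / 2 < (1 + t - 8 * t^2) / 2"
  "(1 + t - 8 * t^2) / 2 < 1 - 2 * t"
  using t t_sq by - argo+

text \<open>The nine pieces of the definition are treated in turn and joined. At a breakpoint the
  case distinction selects the piece on its left; the adjacent formulas agree there because the
  cutoff is \<open>0\<close> or \<open>1\<close>.\<close>

lemma incr_bounds_hat_h: "incr_bounds t ((1 + 3 * M) / t) (hat_h \<psi> t) 0 1"
proof -
  let ?I = "incr_bounds t ((1 + 3 * M) / t) (hat_h \<psi> t)"
  note bp = t breakpoints t_sq
  have p1: "?I 0 t"
    by (subst incr_bounds_cong[where g = "\<lambda>x. x"])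
       (auto simp: hat_h_def intro: incr_bounds_pieces' incr_bounds_pieces)
  have p2: "?I t (2 * t)"
  proof (subst incr_bounds_cong)
    show "hat_h \<psi> t x = blend \<psi> ((x - t) / t) x (A_map t x)" if "t \<le> x" "x \<le> 2 * t" for x
      using that t by (auto simp: hat_h_def blend_def \<psi>_simps)
    show "incr_bounds t ((1 + 3 * M) / t) (\<lambda>x. blend \<psi> ((x - t) / t) x (A_map t x)) t (2 * t)"
    proof (rule incr_bounds_transition)
      fix x assume x: "t \<le> x" "x \<le> 2 * t"
      have "0 \<le> t * x" "t * x \<le> t * 1" using x t by (auto intro!: mult_left_mono)
      moreover have "3 / t * t = 3" using t by simp
      ultimately show "0 \<le> A_map t x - x \<and> A_map t x - x \<le> 3 / t * t"
        using x t A_map_eq[of x] A'_map_eq[of x] by linarith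
    qed (use t incr_bounds_pieces in auto)
  qed
  have p3: "?I (2 * t) ((1 - t + 8 * t^2) / 2)"
  proof (subst incr_bounds_cong)
    show "hat_h \<psi> t x = A_map t x" if "2 * t \<le> x" "x \<le> (1 - t + 8 * t^2) / 2" for x
      using that t by (cases "x = 2 * t") (auto simp: hat_h_def blend_def \<psi>_simps)
  qed (auto intro: incr_bounds_pieces' incr_bounds_pieces)
  have p4: "?I ((1 - t + 8 * t^2) / 2) ((1 - t + 10 * t^2) / 2)"
  proof (subst incr_bounds_cong)
    show "hat_h \<psi> t x = blend \<psi> ((x - (1 - t + 8 * t^2) / 2) / t^2) (A_map t x) (B_map t x)"
      if "(1 - t + 8 * t^2) / 2 \<le> x" "x \<le> (1 - t + 10 * t^2) / 2" for x
    proof (cases "x = (1 - t + 8 * t^2) / 2")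
      case True
      moreover have "hat_h \<psi> t x = A_map t x"
      proof -
        have "\<not> x \<le> t" "\<not> x \<le> 2 * t"
          using True bp by linarith+
        then show ?thesis using True by (simp add: hat_h_def)
      qed
      moreover have "(x - (1 - t + 8 * t^2) / 2) / t^2 = 0"
        unfolding True by simp
      ultimately show ?thesis by (simp only: blend_ends)
    next
      case False
      then have "\<not> x \<le> t" "\<not> x \<le> 2 * t" "\<not> x \<le> (1 - t + 8 * t^2) / 2"
        using that bp by linarith+
      then show ?thesis using that by (simp add: hat_h_def)
    qed
    show "incr_bounds t ((1 + 3 * M) / t)
        (\<lambda>x. blend \<psi> ((x - (1 - t + 8 * t^2) / 2) / t^2) (A_map t x) (B_map t x))
        ((1 - t + 8 * t^2) / 2) ((1 - t + 10 * t^2) / 2)"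
    proof (rule incr_bounds_transition)
      fix x assume x: "(1 - t + 8 * t^2) / 2 \<le> x" "x \<le> (1 - t + 10 * t^2) / 2"
      \<comment> \<open>On this window \<open>A_map\<close> stays between \<open>3 * t\<close> and
        \<open>13/4 * t\<close> while \<open>B_map\<close> runs from \<open>4 * t\<close> to
        \<open>5 * t\<close>. The gap is therefore positive and at most
        \<open>2 * t\<close>.\<close>
      have "t * (3/8) \<le> t * x" "t * x \<le> t * (1/2)"
        using x t t_sq by (auto intro!: mult_left_mono)
      then have A: "3 * t \<le> A_map t x" "A_map t x \<le> 3 * t + t / 4"
        using t A_map_eq[of x] by - linarith+
      have "4 * t - 1/2 \<le> (x - 1/2) / t" "(x - 1/2) / t \<le> 5 * t - 1/2"
        using x by (simp_all add: pos_le_divide_eq[OF t(1)] pos_divide_le_eq[OF t(1)] power2_eq_square left_diff_distrib)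
      then have B: "4 * t \<le> B_map t x" "B_map t x \<le> 5 * t"
        by (auto simp: B_map_def)
      have "3 / t * t^2 = 3 * t" using t by (simp add: power2_eq_square)
      then show "0 \<le> B_map t x - A_map t x \<and> B_map t x - A_map t x \<le> 3 / t * t^2"
        using A B t by linarith
    qed (use t incr_bounds_pieces in auto)
  qed
  have p5: "?I ((1 - t + 10 * t^2) / 2) ((1 + t - 10 * t^2) / 2)"
  proof (subst incr_bounds_cong)
    show "hat_h \<psi> t x = B_map t x"
      if "(1 - t + 10 * t^2) / 2 \<le> x" "x \<le> (1 + t - 10 * t^2) / 2" for x
    proof (cases "x = (1 - t + 10 * t^2) / 2")
      case True
      then have "\<not> x \<le> t" "\<not> x \<le> 2 * t" "\<not> x \<le> (1 - t + 8 * t^2) / 2"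
        using bp by linarith+
      then have "hat_h \<psi> t x = blend \<psi> ((x - (1 - t + 8 * t^2) / 2) / t^2) (A_map t x) (B_map t x)"
        using True by (simp add: hat_h_def)
      moreover have "(x - (1 - t + 8 * t^2) / 2) / t^2 = 1"
        unfolding True using t by (simp add: field_simps)
      ultimately show ?thesis by (simp only: blend_ends)
    next
      case False
      then have "\<not> x \<le> t" "\<not> x \<le> 2 * t" "\<not> x \<le> (1 - t + 8 * t^2) / 2" "\<not> x \<le> (1 - t + 10 * t^2) / 2"
        using that bp by linarith+
      then show ?thesis using that by (simp add: hat_h_def)
    qed
  qed (auto intro: incr_bounds_pieces' incr_bounds_pieces)
  have p6: "?I ((1 + t - 10 * t^2) / 2) ((1 + t - 8 * t^2) / 2)"
  proof (subst incr_bounds_cong)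
    show "hat_h \<psi> t x = blend \<psi> ((x - (1 + t - 10 * t^2) / 2) / t^2) (B_map t x) (A'_map t x)"
      if "(1 + t - 10 * t^2) / 2 \<le> x" "x \<le> (1 + t - 8 * t^2) / 2" for x
    proof (cases "x = (1 + t - 10 * t^2) / 2")
      case True
      then have "\<not> x \<le> t" "\<not> x \<le> 2 * t" "\<not> x \<le> (1 - t + 8 * t^2) / 2" "\<not> x \<le> (1 - t + 10 * t^2) / 2"
        using bp by linarith+
      then have "hat_h \<psi> t x = B_map t x" using True by (simp add: hat_h_def)
      moreover have "(x - (1 + t - 10 * t^2) / 2) / t^2 = 0"
        unfolding True by simp
      ultimately show ?thesis by (simp only: blend_ends)
    next
      case False
      then have "\<not> x \<le> t" "\<not> x \<le> 2 * t" "\<not> x \<le> (1 - t + 8 * t^2) / 2" "\<not> x \<le> (1 - t + 10 * t^2) / 2"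
        "\<not> x \<le> (1 + t - 10 * t^2) / 2"
        using that bp by linarith+
      then show ?thesis using that by (simp add: hat_h_def)
    qed
    show "incr_bounds t ((1 + 3 * M) / t)
        (\<lambda>x. blend \<psi> ((x - (1 + t - 10 * t^2) / 2) / t^2) (B_map t x) (A'_map t x))
        ((1 + t - 10 * t^2) / 2) ((1 + t - 8 * t^2) / 2)"
    proof (rule incr_bounds_transition)
      fix x assume x: "(1 + t - 10 * t^2) / 2 \<le> x" "x \<le> (1 + t - 8 * t^2) / 2"
      have "t * (1/2) \<le> t * x" "t * x \<le> t * (5/8)"
        using x t t_sq by (auto intro!: mult_left_mono)
      then have A: "1 - 3 * t - t / 4 \<le> A'_map t x" "A'_map t x \<le> 1 - 3 * t"
        using t A'_map_eq[of x] by - linarith+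
      have "1/2 - 5 * t \<le> (x - 1/2) / t" "(x - 1/2) / t \<le> 1/2 - 4 * t"
        using x by (simp_all add: pos_le_divide_eq[OF t(1)] pos_divide_le_eq[OF t(1)] power2_eq_square left_diff_distrib)
      then have B: "1 - 5 * t \<le> B_map t x" "B_map t x \<le> 1 - 4 * t"
        by (auto simp: B_map_def)
      have "3 / t * t^2 = 3 * t" using t by (simp add: power2_eq_square)
      then show "0 \<le> A'_map t x - B_map t x \<and> A'_map t x - B_map t x \<le> 3 / t * t^2"
        using A B t by linarith
    qed (use t incr_bounds_pieces in auto)
  qed
  have p7: "?I ((1 + t - 8 * t^2) / 2) (1 - 2 * t)"
  proof (subst incr_bounds_cong)
    show "hat_h \<psi> t x = A'_map t x"
      if "(1 + t - 8 * t^2) / 2 \<le> x" "x \<le> 1 - 2 * t" for x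
    proof (cases "x = (1 + t - 8 * t^2) / 2")
      case True
      then have "\<not> x \<le> t" "\<not> x \<le> 2 * t" "\<not> x \<le> (1 - t + 8 * t^2) / 2" "\<not> x \<le> (1 - t + 10 * t^2) / 2"
        "\<not> x \<le> (1 + t - 10 * t^2) / 2"
        using bp by linarith+
      then have "hat_h \<psi> t x = blend \<psi> ((x - (1 + t - 10 * t^2) / 2) / t^2) (B_map t x) (A'_map t x)"
        using True by (simp add: hat_h_def)
      moreover have "(x - (1 + t - 10 * t^2) / 2) / t^2 = 1"
        unfolding True using t by (simp add: field_simps)
      ultimately show ?thesis by (simp only: blend_ends)
    next
      case False
      then have "\<not> x \<le> t" "\<not> x \<le> 2 * t" "\<not> x \<le> (1 - t + 8 * t^2) / 2" "\<not> x \<le> (1 - t + 10 * t^2) / 2"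
        "\<not> x \<le> (1 + t - 10 * t^2) / 2" "\<not> x \<le> (1 + t - 8 * t^2) / 2"
        using that bp by linarith+
      then show ?thesis using that by (simp add: hat_h_def)
    qed
  qed (auto intro: incr_bounds_pieces' incr_bounds_pieces)
  have p8: "?I (1 - 2 * t) (1 - t)"
  proof (subst incr_bounds_cong)
    show "hat_h \<psi> t x = blend \<psi> ((x - (1 - 2 * t)) / t) (A'_map t x) x"
      if "1 - 2 * t \<le> x" "x \<le> 1 - t" for x
    proof (cases "x = 1 - 2 * t")
      case True
      then have "\<not> x \<le> t" "\<not> x \<le> 2 * t" "\<not> x \<le> (1 - t + 8 * t^2) / 2" "\<not> x \<le> (1 - t + 10 * t^2) / 2"
        "\<not> x \<le> (1 + t - 10 * t^2) / 2" "\<not> x \<le> (1 + t - 8 * t^2) / 2"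
        using bp by linarith+
      then show ?thesis using True by (simp add: hat_h_def blend_def \<psi>_simps)
    next
      case False
      then have "\<not> x \<le> t" "\<not> x \<le> 2 * t" "\<not> x \<le> (1 - t + 8 * t^2) / 2" "\<not> x \<le> (1 - t + 10 * t^2) / 2"
        "\<not> x \<le> (1 + t - 10 * t^2) / 2" "\<not> x \<le> (1 + t - 8 * t^2) / 2" "\<not> x \<le> 1 - 2 * t"
        using that bp by linarith+
      moreover have eq: "x - (1 - 2 * t) = x - 1 + 2 * t" by simp
      ultimately show ?thesis using that unfolding eq by (simp add: hat_h_def)
    qed
    show "incr_bounds t ((1 + 3 * M) / t)
        (\<lambda>x. blend \<psi> ((x - (1 - 2 * t)) / t) (A'_map t x) x) (1 - 2 * t) (1 - t)"
    proof (rule incr_bounds_transition)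
      fix x assume x: "1 - 2 * t \<le> x" "x \<le> 1 - t"
      have "0 \<le> t * x" "t * x \<le> t * 1" using x t by (auto intro!: mult_left_mono)
      moreover have "3 / t * t = 3" using t by simp
      ultimately show "0 \<le> x - A'_map t x \<and> x - A'_map t x \<le> 3 / t * t"
        using x t A_map_eq[of x] A'_map_eq[of x] by linarith
    qed (use t incr_bounds_pieces in auto)
  qed
  have p9: "?I (1 - t) 1"
  proof (subst incr_bounds_cong)
    show "hat_h \<psi> t x = x" if "1 - t \<le> x" "x \<le> 1" for x
    proof -
      have "\<not> x \<le> t" "\<not> x \<le> 2 * t" "\<not> x \<le> (1 - t + 8 * t^2) / 2" "\<not> x \<le> (1 - t + 10 * t^2) / 2"
        "\<not> x \<le> (1 + t - 10 * t^2) / 2" "\<not> x \<le> (1 + t - 8 * t^2) / 2" "\<not> x \<le> 1 - 2 * t"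
        using that bp by linarith+
      then show ?thesis using that t by (auto simp: hat_h_def blend_def \<psi>_simps)
    qed
  qed (auto intro: incr_bounds_pieces' incr_bounds_pieces)
  show ?thesis
    using p1 p2 p3 p4 p5 p6 p7 p8 p9 by (meson incr_bounds_join)
qed

end

section \<open>Periodic combs and the measure of their images\<close>

definition comb :: "nat \<Rightarrow> real \<Rightarrow> real \<Rightarrow> real set" where
  "comb q u v = {z. \<exists>l::int. of_int l + u \<le> real q * z \<and> real q * z \<le> of_int l + v}"

lemma comb_measurable [measurable]: "comb q u v \<in> sets borel"
  unfolding comb_def by measurable

lemma comb_add_int:
  assumes "z \<in> comb q u v"
  shows "z + of_int k \<in> comb q u v"
proof -
  obtain l where "of_int l + u \<le> real q * z" "real q * z \<le> of_int l + v"
    using assms by (auto simp: comb_def)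
  then show ?thesis
    unfolding comb_def by (auto intro!: exI[of _ "l + int q * k"] simp: algebra_simps)
qed

lemma comb_thicken:
  assumes "z \<in> comb q u v" "real q * \<bar>x - z\<bar> \<le> d"
  shows "x \<in> comb q (u - d) (v + d)"
proof -
  obtain l where l: "of_int l + u \<le> real q * z" "real q * z \<le> of_int l + v"
    using assms by (auto simp: comb_def)
  have "\<bar>real q * x - real q * z\<bar> \<le> d"
    using assms(2) by (simp add: abs_mult flip: right_diff_distrib)
  with l have "of_int l + (u - d) \<le> real q * x \<and> real q * x \<le> of_int l + (v + d)"
    by linarith
  then show ?thesis by (auto simp: comb_def)
qed

text \<open>The bounds on \<open>u\<close> and \<open>v\<close> leave only the \<open>q + 4\<close>
  indices from \<open>-2\<close> to \<open>q + 1\<close> for teeth that meet \<open>[0,1]\<close>.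
  Each tooth has length \<open>(v - u) / q\<close> and is stretched at most by \<open>L\<close>;
  \<open>(q + 4) / q \<le> 5\<close> gives the constant.\<close>

lemma emeasure_image_comb:
  assumes f: "normal_lift L f" and "q > 0" and uv: "-1 \<le> u" "u \<le> v" "v \<le> 2"
    and X: "X \<subseteq> f ` (comb q u v \<inter> {0..1})"
  shows "emeasure lborel X \<le> ennreal (5 * L * (v - u))"
proof -
  have L: "L \<ge> 1" using f by (simp add: normal_lift_def)
  have q: "real q \<ge> 1" using \<open>q > 0\<close> by simp
  have mono: "f x \<le> f y" if "x \<le> y" for x y
    using normal_lift_circle_homeo[OF f] that by (simp add: circle_homeo_def strict_mono_less_eq)
  define I where "I l = {f ((of_int l + u) / q)..f ((of_int l + v) / q)}" for l :: int
  let ?S = "{-2..int q + 1}"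
  have "X \<subseteq> (\<Union>l\<in>?S. I l)"
  proof
    fix x assume "x \<in> X"
    then obtain y l where y: "x = f y" "0 \<le> y" "y \<le> 1" "of_int l + u \<le> real q * y" "real q * y \<le> of_int l + v"
      using X by (auto simp: comb_def)
    have "0 \<le> real q * y" "real q * y \<le> real q"
      using y q by (auto intro: mult_left_le)
    then have "real_of_int l \<ge> -2" "real_of_int l \<le> real q + 1"
      using y uv by linarith+
    then have "l \<in> ?S" by auto
    moreover have "(of_int l + u) / q \<le> y" "y \<le> (of_int l + v) / q"
      using y(4,5) q by (auto simp: field_simps)
    then have "x \<in> I l"
      unfolding I_def y(1) by (auto intro: mono)
    ultimately show "x \<in> (\<Union>l\<in>?S. I l)" by blast
  qed
  then have "emeasure lborel X \<le> emeasure lborel (\<Union>l\<in>?S. I l)"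
    by (rule emeasure_mono) (auto simp: I_def)
  also have "\<dots> \<le> (\<Sum>l\<in>?S. emeasure lborel (I l))"
    by (rule emeasure_subadditive_finite) (auto simp: I_def)
  also have "\<dots> \<le> (\<Sum>l\<in>?S. ennreal (L * ((v - u) / q)))"
  proof (rule sum_mono)
    fix l assume "l \<in> ?S"
    have le: "(of_int l + u) / q \<le> (of_int l + v) / q"
      using uv q by (simp add: divide_right_mono)
    have "(of_int l + v) / q - (of_int l + u) / q = (v - u) / q"
      by (simp flip: diff_divide_distrib)
    then have "f ((of_int l + v) / q) - f ((of_int l + u) / q) \<le> L * ((v - u) / q)"
      using f le unfolding normal_lift_def by metis
    then show "emeasure lborel (I l) \<le> ennreal (L * ((v - u) / q))"
      using mono[OF le] by (simp add: I_def ennreal_leI)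
  qed
  also have "\<dots> = ennreal (\<Sum>l\<in>?S. L * ((v - u) / q))"
    using L uv by (intro sum_ennreal) auto
  also have "\<dots> \<le> ennreal (5 * L * (v - u))"
  proof (rule ennreal_leI)
    have "(real q + 4) / q \<le> 5" using q by (simp add: field_simps)
    then have "(real q + 4) / q * (L * (v - u)) \<le> 5 * (L * (v - u))"
      using L uv by (intro mult_right_mono) auto
    then show "(\<Sum>l\<in>?S. L * ((v - u) / q)) \<le> 5 * L * (v - u)"
      by (simp add: mult.assoc add.commute)
  qed
  finally show ?thesis .
qed

context circle_block
begin

lemma hat_h_incr:
  assumes "0 \<le> x" "x \<le> y" "y \<le> 1"
  shows "t * (y - x) \<le> hat_h \<psi> t y - hat_h \<psi> t x"
    and "hat_h \<psi> t y - hat_h \<psi> t x \<le> (1 + 3 * M) / t * (y - x)"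
    and "hat_h \<psi> t x \<le> hat_h \<psi> t y"
proof -
  show *: "t * (y - x) \<le> hat_h \<psi> t y - hat_h \<psi> t x"
    "hat_h \<psi> t y - hat_h \<psi> t x \<le> (1 + 3 * M) / t * (y - x)"
    using incr_bounds_hat_h assms by (auto simp: incr_bounds_def)
  have "0 \<le> t * (y - x)" using t assms by simp
  with * show "hat_h \<psi> t x \<le> hat_h \<psi> t y" by linarith
qed

lemma hat_h_ends: "hat_h \<psi> t 0 = 0" "hat_h \<psi> t 1 = 1"
proof -
  show "hat_h \<psi> t 0 = 0" using t by (simp add: hat_h_def)
  have "\<not> 1 \<le> t" "\<not> 1 \<le> 2 * t" "\<not> 1 \<le> (1 - t + 8 * t^2) / 2" "\<not> 1 \<le> (1 - t + 10 * t^2) / 2"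
    "\<not> 1 \<le> (1 + t - 10 * t^2) / 2" "\<not> 1 \<le> (1 + t - 8 * t^2) / 2" "\<not> 1 \<le> 1 - 2 * t" "\<not> 1 \<le> 1 - t"
    using t breakpoints by linarith+
  then show "hat_h \<psi> t 1 = 1" unfolding hat_h_def by (simp only: if_False)
qed

lemma hat_h_range:
  assumes "0 \<le> x" "x \<le> 1"
  shows "0 \<le> hat_h \<psi> t x" "hat_h \<psi> t x \<le> 1"
  using hat_h_incr(3)[of 0 x] hat_h_incr(3)[of x 1] hat_h_ends assms by auto

text \<open>By monotonicity it suffices to look at the end \<open>b\<close> of the stretch governed
  by \<open>A_map\<close>, which lies slightly to the right of \<open>(1 - t) / 2\<close>.\<close>

lemma hat_h_left:
  assumes "0 \<le> x" "x \<le> (1 - t) / 2"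
  shows "hat_h \<psi> t x \<le> 4 * t"
proof -
  define b where "b = (1 - t + 8 * t^2) / 2"
  have b: "\<not> b \<le> t" "\<not> b \<le> 2 * t" "b < 1/2 + t / 10"
    using t t_sq breakpoints unfolding b_def by - argo+
  have "x \<le> b" using assms t_sq unfolding b_def by argo
  then have "hat_h \<psi> t x \<le> hat_h \<psi> t b"
    using assms b t by (intro hat_h_incr(3)) auto
  also have "hat_h \<psi> t b = A_map t b"
    using b by (simp add: hat_h_def b_def)
  also have "\<dots> \<le> 4 * t"
  proof -
    have "t * b \<le> t * 1" using b t by (intro mult_left_mono) auto
    then show ?thesis unfolding A_map_eq using t by linarith
  qed
  finally show ?thesis .
qed

text \<open>Mirror image of \<open>hat_h_left\<close>, evaluated where the second inner transition
  ends; there the definition still selects the blend, whose cutoff has reached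
  \<open>1\<close>.\<close>

lemma hat_h_right:
  assumes "(1 + t) / 2 \<le> x" "x \<le> 1"
  shows "1 - 4 * t \<le> hat_h \<psi> t x"
proof -
  define b where "b = (1 + t - 8 * t^2) / 2"
  have b: "\<not> b \<le> t" "\<not> b \<le> 2 * t" "\<not> b \<le> (1 - t + 8 * t^2) / 2" "\<not> b \<le> (1 - t + 10 * t^2) / 2"
    "\<not> b \<le> (1 + t - 10 * t^2) / 2"
    using t breakpoints unfolding b_def by linarith+
  have s: "(b - (1 + t - 10 * t^2) / 2) / t^2 = 1"
    unfolding b_def using t by (simp add: field_simps)
  have "1 - 4 * t \<le> A'_map t b"
  proof -
    have "0 \<le> t * b" using b t by simp
    then show ?thesis unfolding A'_map_eq using t by linarith
  qed
  also have "A'_map t b = hat_h \<psi> t b"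
  proof -
    have "b \<le> (1 + t - 8 * t^2) / 2" by (simp add: b_def)
    with b have "hat_h \<psi> t b = blend \<psi> ((b - (1 + t - 10 * t^2) / 2) / t^2) (B_map t b) (A'_map t b)"
      by (simp add: hat_h_def)
    then show ?thesis unfolding s by (simp only: blend_ends)
  qed
  also have "\<dots> \<le> hat_h \<psi> t x"
  proof (rule hat_h_incr(3))
    show "b \<le> x" using assms t_sq unfolding b_def by argo
  qed (use assms b t in auto)
  finally show ?thesis .
qed

text \<open>Rescaling by \<open>q\<close> on both sides leaves ratios of increments unchanged, and
  each cell of length \<open>1 / q\<close> is mapped to itself. Outside the middle part of a cell,
  of relative length \<open>t\<close>, the image lies within relative distance \<open>4 * t\<close>
  of an endpoint of the cell.\<close>

lemma cover_h_lift:
  assumes "q > 0"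
  shows "normal_lift ((1 + 3 * M) / t) (cover_h \<psi> q t)"
    and "\<bar>cover_h \<psi> q t x - x\<bar> \<le> 1 / q"
    and "x \<in> comb q ((1 - t) / 2) ((1 + t) / 2) \<or> cover_h \<psi> q t x \<in> comb q (- 4 * t) (4 * t)"
proof -
  define f where "f x = of_int \<lfloor>x\<rfloor> + hat_h \<psi> t (frac x)" for x :: real
  have cover: "cover_h \<psi> q t x = f (q * x) / q" for x :: real
    by (simp add: cover_h_def f_def)
  have q: "real q > 0" using assms by simp
  define C where "C = (1 + 3 * M) / t"
  have C: "t \<le> 1" "1 \<le> C" "1 / C \<le> t"
    using t M by (auto simp: C_def field_simps)
  have fr: "0 \<le> frac x" "frac x \<le> 1" "x = of_int \<lfloor>x\<rfloor> + frac x" for x :: real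
    by (auto simp: frac_def frac_lt_1 less_imp_le) linarith
  have f: "t * (y - x) \<le> f y - f x \<and> f y - f x \<le> C * (y - x)" if "x \<le> y" for x y
  proof (cases "\<lfloor>x\<rfloor> = \<lfloor>y\<rfloor>")
    case True
    then have "frac x \<le> frac y" "frac y - frac x = y - x" using that by (auto simp: frac_def)
    then show ?thesis
      using hat_h_incr[of "frac x" "frac y"] fr True by (simp add: f_def C_def)
  next
    case False
    then have "\<lfloor>x\<rfloor> + 1 \<le> \<lfloor>y\<rfloor>" using floor_mono[OF that] by linarith
    \<comment> \<open>For points in different cells the increment splits into \<open>r\<close> whole
      cells, over which \<open>f\<close> grows by exactly \<open>r\<close>, and one partial cell at
      either end.\<close>
    define r where "r = real_of_int (\<lfloor>y\<rfloor> - \<lfloor>x\<rfloor> - 1)"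
    have r: "0 \<le> r" using \<open>\<lfloor>x\<rfloor> + 1 \<le> \<lfloor>y\<rfloor>\<close> by (simp add: r_def)
    have yx: "y - x = r + frac y + (1 - frac x)"
      using fr(3)[of x] fr(3)[of y] by (simp add: r_def)
    have fyx: "f y - f x = r + hat_h \<psi> t (frac y) + (1 - hat_h \<psi> t (frac x))"
      by (simp add: f_def r_def)
    have "t * r \<le> r" "r \<le> C * r"
      using r C mult_right_mono[of t 1 r] mult_right_mono[of 1 C r] by auto
    moreover have "t * frac y \<le> hat_h \<psi> t (frac y)" "hat_h \<psi> t (frac y) \<le> C * frac y"
      using hat_h_incr(1,2)[of 0 "frac y"] fr hat_h_ends by (auto simp: C_def)
    moreover have "t * (1 - frac x) \<le> 1 - hat_h \<psi> t (frac x)" "1 - hat_h \<psi> t (frac x) \<le> C * (1 - frac x)"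
      using hat_h_incr(1,2)[of "frac x" 1] fr hat_h_ends by (auto simp: C_def)
    ultimately show ?thesis
      unfolding yx fyx distrib_left by linarith
  qed
  show "normal_lift ((1 + 3 * M) / t) (cover_h \<psi> q t)"
    unfolding normal_lift_def C_def[symmetric]
  proof (intro conjI allI impI)
    show "cover_h \<psi> q t 0 = 0" by (simp add: cover f_def hat_h_ends)
    show "cover_h \<psi> q t (x + 1) = cover_h \<psi> q t x + 1" for x
    proof -
      have "f (z + of_nat q) = f z + of_nat q" for z
        by (simp add: f_def frac_def)
      then show ?thesis using q by (simp add: cover distrib_left add_divide_distrib)
    qed
    fix x y :: real assume "x \<le> y"
    then have "t * (q * y - q * x) \<le> f (q * y) - f (q * x)" "f (q * y) - f (q * x) \<le> C * (q * y - q * x)"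
      using f[of "q * x" "q * y"] q by auto
    then have "t * (q * y - q * x) / q \<le> (f (q * y) - f (q * x)) / q"
      "(f (q * y) - f (q * x)) / q \<le> C * (q * y - q * x) / q"
      using q by (auto intro: divide_right_mono)
    then have *: "t * (y - x) \<le> cover_h \<psi> q t y - cover_h \<psi> q t x"
      "cover_h \<psi> q t y - cover_h \<psi> q t x \<le> C * (y - x)"
      using q by (auto simp: cover diff_divide_distrib right_diff_distrib)
    show "cover_h \<psi> q t y - cover_h \<psi> q t x \<le> C * (y - x)" by fact
    have "(y - x) * (1 / C) \<le> (y - x) * t"
      using C \<open>x \<le> y\<close> by (intro mult_left_mono) auto
    then show "(y - x) / C \<le> cover_h \<psi> q t y - cover_h \<psi> q t x"
      using *(1) by (simp add: mult.commute)
  qed (use C in auto)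
  have "\<bar>f z - z\<bar> \<le> 1" for z
    using fr[of z] hat_h_range[of "frac z"] unfolding f_def by linarith
  then have "\<bar>f (q * x) - q * x\<bar> / q \<le> 1 / q"
    using q by (intro divide_right_mono) auto
  then show "\<bar>cover_h \<psi> q t x - x\<bar> \<le> 1 / q"
    using q abs_divide[of "f (q * x) - q * x" "real q"] by (simp add: cover diff_divide_distrib)
  have qc: "real q * cover_h \<psi> q t x = of_int \<lfloor>real q * x\<rfloor> + hat_h \<psi> t (frac (real q * x))"
    using q by (simp add: cover f_def)
  note z = fr[of "real q * x"]
  consider "frac (real q * x) < (1 - t) / 2" | "frac (real q * x) > (1 + t) / 2"
    | "(1 - t) / 2 \<le> frac (real q * x)" "frac (real q * x) \<le> (1 + t) / 2" by linarith
  then show "x \<in> comb q ((1 - t) / 2) ((1 + t) / 2) \<or> cover_h \<psi> q t x \<in> comb q (- 4 * t) (4 * t)"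
  proof cases
    case 1
    then have "cover_h \<psi> q t x \<in> comb q (- 4 * t) (4 * t)"
      unfolding comb_def mem_Collect_eq qc
      using hat_h_left[of "frac (real q * x)"] hat_h_range(1)[OF z(1,2)] z t
      by (intro exI[of _ "\<lfloor>real q * x\<rfloor>"]) auto
    then show ?thesis ..
  next
    case 2
    \<comment> \<open>The right end of a cell belongs to the tooth around the next integer, hence
      the index \<open>\<lfloor>real q * x\<rfloor> + 1\<close>.\<close>
    then have "cover_h \<psi> q t x \<in> comb q (- 4 * t) (4 * t)"
      unfolding comb_def mem_Collect_eq qc
      using hat_h_right[of "frac (real q * x)"] hat_h_range(2)[OF z(1,2)] z t
      by (intro exI[of _ "\<lfloor>real q * x\<rfloor> + 1"]) auto
    then show ?thesis ..
  next
    case 3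
    then have "x \<in> comb q ((1 - t) / 2) ((1 + t) / 2)"
      unfolding comb_def mem_Collect_eq using z(3)
      by (intro exI[of _ "\<lfloor>real q * x\<rfloor>"]) linarith
    then show ?thesis ..
  qed
qed

end

section \<open>Singularity\<close>

text \<open>Borel-Cantelli is applied twice. The limit superior of \<open>D\<close> is null for
  \<open>M\<close>; a point outside it is eventually outside every \<open>D n\<close>, hence in the
  limit superior of the complements, which is null for \<open>N\<close>.\<close>

lemma mutually_singularI_summable:
  assumes sets: "sets M = sets N" and c: "summable c" "\<And>n. c n \<ge> (0::real)"
    and D: "\<And>n. D n \<in> sets M" "\<And>n. emeasure M (D n) \<le> ennreal (c n)"
      "\<And>n. emeasure N (space N - D n) \<le> ennreal (c n)"
  shows "mutually_singular M N"
proof -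
  have *: "limsup B \<in> null_sets L"
    if "\<And>n. B n \<in> sets L" "\<And>n. emeasure L (B n) \<le> ennreal (c n)" for L :: "'a measure" and B
  proof (rule borel_cantelli_limsup1)
    show "emeasure L (B n) < \<infinity>" for n
      using that(2)[of n] by (simp add: le_less_trans)
    have "measure L (B n) \<le> c n" for n
      using that(2)[of n] c(2) by (simp add: measure_def enn2real_leI)
    then show "summable (\<lambda>n. measure L (B n))"
      by (intro summable_comparison_test'[OF c(1)]) simp
  qed (rule that)
  have A: "limsup D \<in> null_sets M"
    by (rule * D)+
  have DN: "D n \<in> sets N" for n
    using D(1) sets by simp
  have B: "limsup (\<lambda>n. space N - D n) \<in> null_sets N"
    by (rule *) (use DN D(3) in auto)
  have "space N - limsup D \<subseteq> limsup (\<lambda>n. space N - D n)"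
  proof
    fix x assume x: "x \<in> space N - limsup D"
    then obtain n where n: "\<And>m. m \<ge> n \<Longrightarrow> x \<notin> D m"
      by (auto simp: limsup_INF_SUP)
    have "\<exists>m\<ge>k. x \<in> space N - D m" for k
      using x n[of "max n k"] by (intro exI[of _ "max n k"]) auto
    then show "x \<in> limsup (\<lambda>n. space N - D n)"
      by (fastforce simp: limsup_INF_SUP)
  qed
  then have "emeasure N (space N - limsup D) = 0"
    using B by (metis emeasure_mono le_zero_eq null_setsD1 null_setsD2)
  then show ?thesis
    using A sets unfolding mutually_singular_def by (auto intro!: bexI[of _ "limsup D"] dest: null_setsD1 null_setsD2)
qed

text \<open>Closeness on the circle controls lifts only up to an integer, which has to be carried
  along.\<close>

lemma circle_dist_lessD:
  assumes "circle_dist x y < e"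
  obtains k :: int where "\<bar>x - y - of_int k\<bar> < e"
proof -
  have ne: "(\<int> :: real set) \<noteq> {}" using Ints_0 by blast
  have "(INF a\<in>\<int>. dist (x - y) a) < e"
    using assms unfolding circle_dist_def infdist_notempty[OF ne] .
  then obtain a where "a \<in> (\<int> :: real set)" "dist (x - y) a < e"
    using cINF_less_iff[OF ne, of "dist (x - y)" e] by (auto intro: bdd_belowI2[where m = 0])
  then show thesis
    by (auto simp: dist_real_def elim!: Ints_cases intro: that)
qed

text \<open>Distances on the circle are bounded, so the supremum in the inverse half of
  \<open>Ck_dist\<close> is finite and dominates the value at each point.\<close>

lemma converges_Ck_0_inv:
  assumes "converges_Ck 0 f g"
  shows "(\<lambda>n. circle_dist (inv (f n) y) (inv g y)) \<longlonglongrightarrow> 0"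
proof (rule real_tendsto_sandwich[OF _ _ tendsto_const])
  have bound: "circle_dist a b \<le> 1" for a b
  proof -
    have "infdist (a - b) \<int> \<le> dist (a - b) (of_int \<lfloor>a - b\<rfloor>)"
      by (rule infdist_le) simp
    also have "\<dots> \<le> 1"
      unfolding dist_real_def by linarith
    finally show ?thesis by (simp add: circle_dist_def)
  qed
  show "\<forall>\<^sub>F n in sequentially. 0 \<le> circle_dist (inv (f n) y) (inv g y)"
    by (simp add: circle_dist_def infdist_nonneg)
  have "circle_dist (inv (f n) y) (inv g y) \<le> Ck_dist 0 (f n) g" for n
  proof -
    have "circle_dist (inv (f n) y) (inv g y) \<le> (SUP x. circle_dist (inv (f n) x) (inv g x))"
      by (rule cSUP_upper) (auto intro!: bdd_aboveI[where M = 1] bound)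
    then show ?thesis by (simp add: Ck_dist_def Ck_diff_def sup_diff_def)
  qed
  then show "\<forall>\<^sub>F n in sequentially. circle_dist (inv (f n) y) (inv g y) \<le> Ck_dist 0 (f n) g"
    by simp
  show "(\<lambda>n. Ck_dist 0 (f n) g) \<longlonglongrightarrow> 0"
    using assms by (simp add: converges_Ck_def)
qed

text \<open>Collects what the measure estimates need from the blocks. As \<open>h_combs\<close>
  leaves the position of the teeth open, it covers a block and its inverse alike; \<open>sum\<close>
  weighs the distortion of the first \<open>m\<close> blocks against the tooth width of the next
  one.\<close>

locale block_composition =
  fixes h Hs :: "nat \<Rightarrow> real \<Rightarrow> real" and q :: "nat \<Rightarrow> nat" and t :: "nat \<Rightarrow> real"
    and K :: real and H :: "real \<Rightarrow> real"
  assumes Hs_0: "Hs 0 = id" and Hs_Suc: "\<And>n. Hs (Suc n) = Hs n \<circ> h (Suc n)"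
    and h_lift: "\<And>n. n \<ge> 1 \<Longrightarrow> normal_lift (K / t n) (h n)"
    and h_near: "\<And>n x. n \<ge> 1 \<Longrightarrow> \<bar>inv (h n) x - x\<bar> \<le> 1 / q n"
    and h_combs: "\<And>n. n \<ge> 1 \<Longrightarrow> \<exists>u v u' v'. -1/2 \<le> u \<and> u \<le> v \<and> v \<le> 1 \<and> v - u \<le> 8 * t n \<and>
      -1/2 \<le> u' \<and> u' \<le> v' \<and> v' \<le> 1 \<and> v' - u' \<le> 8 * t n \<and>
      (\<forall>y. inv (h n) y \<in> comb (q n) u v \<or> y \<in> comb (q n) u' v')"
    and q_pos: "\<And>n. n \<ge> 1 \<Longrightarrow> q n > 0"
    and q_growth: "\<And>n. n \<ge> 1 \<Longrightarrow> 2 * q n \<le> q (Suc n)"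
    and q_t: "\<And>n. n \<ge> 1 \<Longrightarrow> real (q n) / q (Suc n) \<le> t n"
    and t_bounds: "\<And>n. n \<ge> 1 \<Longrightarrow> 0 < t n \<and> t n < 1/10"
    and sum: "summable (\<lambda>m. (\<Prod>j=1..m. K / t j) * t (Suc m))"
    and H: "circle_homeo H"
    and conv: "\<And>y. (\<lambda>n. circle_dist (inv (Hs n) y) (inv H y)) \<longlonglongrightarrow> 0"
begin

lemma Hs_lift: "normal_lift (\<Prod>j=1..n. K / t j) (Hs n)"
proof (induction n)
  case 0
  show ?case by (simp add: Hs_0 normal_lift_def)
next
  case (Suc n)
  then show ?case
    using normal_lift_compose[OF Suc h_lift[of "Suc n"]] by (simp add: Hs_Suc mult.commute comp_def)
qed

lemmas Hs_homeo = normal_lift_circle_homeo[OF Hs_lift]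
lemmas Hs_bij = circle_homeo_bij[OF Hs_homeo]

lemma inv_Hs_Suc: "inv (Hs (Suc n)) x = inv (h (Suc n)) (inv (Hs n) x)"
  using o_inv_distrib[OF Hs_bij circle_homeo_bij[OF normal_lift_circle_homeo[OF h_lift]], of "Suc n" n]
  by (simp add: Hs_Suc)

text \<open>Each further inverse block moves a point by at most \<open>1 / q\<close>, and doubling
  makes the total geometric. The subtracted \<open>1 / q N\<close> is the room for the induction,
  since \<open>2 / q (Suc N) \<le> 1 / q N\<close>.\<close>

lemma inv_Hs_near:
  assumes "n < N"
  shows "\<bar>inv (Hs N) w - inv (Hs n) w\<bar> \<le> 2 / q (Suc n) - 1 / q N"
  using Suc_leI[OF assms]
proof (induction N rule: dec_induct)
  case base
  show ?case using h_near[of "Suc n" "inv (Hs n) w"] by (simp add: inv_Hs_Suc)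
next
  case (step N)
  have "\<bar>inv (Hs (Suc N)) w - inv (Hs N) w\<bar> \<le> 1 / q (Suc N)"
    using h_near[of "Suc N"] by (simp add: inv_Hs_Suc)
  moreover have "2 / real (q (Suc N)) \<le> 1 / q N"
  proof -
    have "q N > 0" "2 * real (q N) \<le> q (Suc N)"
      using q_pos[of N] q_growth[of N] step by (simp, linarith)
    then show ?thesis by (simp add: field_simps)
  qed
  ultimately show ?case using step.IH step.hyps by linarith
qed

text \<open>Passage to the limit along a sufficiently large \<open>N\<close>: the blocks after
  \<open>n\<close> contribute \<open>2 / q (Suc n)\<close> and the remaining distance to the limit
  another \<open>1 / q (Suc n)\<close>.\<close>

lemma inv_H_near:
  obtains k :: int where "\<bar>inv H (Hs n z) - z + of_int k\<bar> \<le> 3 / q (Suc n)"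
proof -
  have q: "1 / real (q (Suc n)) > 0" using q_pos[of "Suc n"] by simp
  have "\<forall>\<^sub>F N in sequentially. circle_dist (inv (Hs N) (Hs n z)) (inv H (Hs n z)) < 1 / q (Suc n)"
    using conv q by (rule order_tendstoD(2))
  then obtain N where N: "N > n" "circle_dist (inv (Hs N) (Hs n z)) (inv H (Hs n z)) < 1 / q (Suc n)"
    by (metis (no_types, lifting) eventually_sequentially Suc_le_eq le_cases order_refl order_trans)
  from circle_dist_lessD[OF N(2)] obtain k where
    "\<bar>inv (Hs N) (Hs n z) - inv H (Hs n z) - of_int k\<bar> < 1 / q (Suc n)" .
  moreover have "inv (Hs n) (Hs n z) = z"
    using Hs_bij by (simp add: bij_is_inj)
  then have "\<bar>inv (Hs N) (Hs n z) - z\<bar> \<le> 2 / q (Suc n)"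
    using inv_Hs_near[OF N(1), of "Hs n z"] by (simp add: order_trans[of _ "2 / q (Suc n) - 1 / q N"])
  moreover have "3 / real (q (Suc n)) = 1 / q (Suc n) + 2 / q (Suc n)"
    by (simp flip: add_divide_distrib)
  ultimately have "\<bar>inv H (Hs n z) - z + of_int k\<bar> \<le> 3 / q (Suc n)"
    by linarith
  then show thesis by (rule that)
qed

text \<open>\<open>D\<close> is the part in \<open>[0,1)\<close> of the image of a comb under
  \<open>Hs (Suc m)\<close>. Its complement lies in an image under \<open>Hs m\<close> of the other
  comb, of measure at most \<open>5 * L * 8 * \<tau>\<close>. Its preimage under \<open>H\<close>
  lies in the first comb thickened by \<open>3 * \<tau>\<close>, of measure at most
  \<open>5 * (8 + 6) * \<tau>\<close>; hence the constant \<open>70\<close>, as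
  \<open>L \<ge> 1\<close>.\<close>

lemma exists_separating_set:
  fixes m :: nat
  defines "c \<equiv> 70 * ((\<Prod>j=1..m. K / t j) * t (Suc m))"
  shows "\<exists>D\<in>sets circle_lebesgue. emeasure (pushforward H) D \<le> ennreal c \<and>
    emeasure circle_lebesgue (space circle_lebesgue - D) \<le> ennreal c"
proof -
  define L where "L = (\<Prod>j=1..m. K / t j)"
  define Q \<tau> G where "Q = q (Suc m)" and "\<tau> = t (Suc m)" and "G = Hs (Suc m)"
  have L: "L \<ge> 1" using Hs_lift[of m] by (simp add: L_def normal_lift_def)
  have c: "c = 70 * (L * \<tau>)" by (simp add: c_def L_def \<tau>_def)
  have \<tau>: "0 < \<tau>" "\<tau> < 1/10" using t_bounds[of "Suc m"] by (auto simp: \<tau>_def)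
  have Q: "Q > 0" using q_pos[of "Suc m"] by (simp add: Q_def)
  have G: "circle_homeo G" "bij G" by (simp_all add: G_def Hs_homeo Hs_bij)
  have G1: "\<forall>x. inv G (x + 1) = inv G x + 1" using circle_homeo_inv(2)[OF G(1)] by blast
  obtain u v u' v' where uv: "-1/2 \<le> u" "u \<le> v" "v \<le> 1" "v - u \<le> 8 * \<tau>"
    and uv': "-1/2 \<le> u'" "u' \<le> v'" "v' \<le> 1" "v' - u' \<le> 8 * \<tau>"
    and dich: "\<And>y. inv (h (Suc m)) y \<in> comb Q u v \<or> y \<in> comb Q u' v'"
    using h_combs[of "Suc m"] unfolding Q_def \<tau>_def by auto
  define D where "D = {x \<in> {0..<1}. inv G x \<in> comb Q u v}"
  have "inv G \<in> borel_measurable borel"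
    by (intro borel_measurable_mono strict_mono_mono circle_homeo_inv(1) G)
  then have "inv G -` comb Q u v \<in> sets borel"
    using measurable_sets[of "inv G" borel borel "comb Q u v"] by simp
  moreover have "D = {0..<1} \<inter> inv G -` comb Q u v"
    by (auto simp: D_def)
  ultimately have D: "D \<in> sets circle_lebesgue"
    by (auto simp: circle_lebesgue_def sets_restrict_space)
  have "emeasure circle_lebesgue (space circle_lebesgue - D) = emeasure lborel ({0..<1} - D)"
    by (simp add: emeasure_circle_lebesgue)
  also have "\<dots> \<le> ennreal (5 * L * (v' - u'))"
  proof (rule emeasure_image_comb[OF Hs_lift[of m, folded L_def] Q])
    show "{0..<1} - D \<subseteq> Hs m ` (comb Q u' v' \<inter> {0..1})"
    proof
      fix x assume x: "x \<in> {0..<1} - D"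
      \<comment> \<open>Only \<open>Hs m\<close> is undone here: the last block then acts on
        \<open>y\<close>, and missing its first comb forces \<open>y\<close> into the second, so no
        distortion of the last block enters.\<close>
      define y where "y = inv (Hs m) x"
      have "Hs m y = x" using Hs_bij[of m] by (simp add: y_def bij_is_surj surj_f_inv_f)
      have "inv (h (Suc m)) y \<notin> comb Q u v"
        using x by (auto simp: D_def G_def y_def inv_Hs_Suc)
      then have "y \<in> comb Q u' v'" using dich by blast
      moreover have "0 \<le> y" "y \<le> 1"
      proof -
        have "strict_mono (Hs m)" "Hs m 0 = 0" "Hs m 1 = 1"
          using Hs_homeo[of m] Hs_lift[of m] unfolding circle_homeo_def normal_lift_def
          by (auto dest: spec[of _ 0])
        then show "0 \<le> y" "y \<le> 1"
          using x \<open>Hs m y = x\<close> strict_mono_less_eq[of "Hs m" 0 y] strict_mono_less_eq[of "Hs m" y 1] by auto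
      qed
      ultimately show "x \<in> Hs m ` (comb Q u' v' \<inter> {0..1})"
        using \<open>Hs m y = x\<close> by (auto intro!: image_eqI[of _ _ y])
    qed
  qed (use uv' in auto)
  also have "\<dots> \<le> ennreal c"
  proof (rule ennreal_leI)
    have "L * (v' - u') \<le> L * (8 * \<tau>)" using uv' L by (intro mult_left_mono) auto
    moreover have "0 \<le> L * \<tau>" using L \<tau> by simp
    ultimately show "5 * L * (v' - u') \<le> c" unfolding c by simp
  qed
  finally have leb: "emeasure circle_lebesgue (space circle_lebesgue - D) \<le> ennreal c" .
  define Y where "Y = (\<lambda>x. frac (H x)) -` D \<inter> {0..<1}"
  have "(\<lambda>x. frac (H x)) \<in> measurable circle_lebesgue circle_lebesgue"
    by (intro measurable_frac_circle circle_homeo_measurable H refl)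
  then have "emeasure (pushforward H) D = emeasure circle_lebesgue Y"
    using D by (simp add: pushforward_def emeasure_distr Y_def)
  also have "\<dots> = emeasure lborel Y"
    by (rule emeasure_circle_lebesgue) (simp add: Y_def)
  also have "\<dots> \<le> ennreal (5 * 1 * ((v + 3 * \<tau>) - (u - 3 * \<tau>)))"
  proof (rule emeasure_image_comb[OF _ Q])
    show "normal_lift 1 id" by (simp add: normal_lift_def)
    show "Y \<subseteq> id ` (comb Q (u - 3 * \<tau>) (v + 3 * \<tau>) \<inter> {0..1})"
    proof
      fix x assume x: "x \<in> Y"
      define z where "z = inv G (H x)"
      have "G z = H x" using G(2) by (simp add: z_def bij_is_surj surj_f_inv_f)
      then have "inv H (G z) = x" using circle_homeo_bij[OF H] by (simp add: bij_is_inj)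
      moreover obtain k where "\<bar>inv H (G z) - z + of_int k\<bar> \<le> 3 / q (Suc (Suc m))"
        using inv_H_near[of "Suc m" z] unfolding G_def by blast
      \<comment> \<open>In units of the tooth spacing \<open>1 / Q\<close> the error
        \<open>3 / q (Suc (Suc m))\<close> becomes at most \<open>3 * \<tau>\<close>, comparable to
        the width of the teeth.\<close>
      ultimately have "Q * \<bar>x - (z + of_int (- k))\<bar> \<le> Q * (3 / q (Suc (Suc m)))"
        by (intro mult_left_mono) (auto simp: algebra_simps)
      also have "\<dots> = 3 * (real (q (Suc m)) / q (Suc (Suc m)))"
        by (simp add: Q_def)
      also have "\<dots> \<le> 3 * \<tau>"
        using q_t[of "Suc m"] unfolding \<tau>_def by (intro mult_left_mono) auto
      finally have near: "Q * \<bar>x - (z + of_int (- k))\<bar> \<le> 3 * \<tau>" .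
      \<comment> \<open>Membership in \<open>D\<close> is tested at \<open>frac (H x)\<close>,
        whereas \<open>z\<close> comes from \<open>H x\<close>; the two preimages differ by an
        integer, and combs are invariant under integers.\<close>
      have "inv G (frac (H x)) \<in> comb Q u v"
        using x by (simp add: Y_def D_def)
      moreover have "z = inv G (frac (H x)) + of_int \<lfloor>H x\<rfloor>"
        using equivariant_add_int[OF G1, of "frac (H x)" "\<lfloor>H x\<rfloor>"] by (simp add: z_def frac_def)
      ultimately have "z \<in> comb Q u v" by (simp add: comb_add_int)
      then have "x \<in> comb Q (u - 3 * \<tau>) (v + 3 * \<tau>)"
        by (rule comb_thicken[OF comb_add_int near])
      then show "x \<in> id ` (comb Q (u - 3 * \<tau>) (v + 3 * \<tau>) \<inter> {0..1})"
        using x by (simp add: Y_def)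
    qed
  qed (use uv \<tau> in auto)
  also have "\<dots> \<le> ennreal c"
  proof (rule ennreal_leI)
    define P where "P = L * \<tau>"
    have "\<tau> \<le> P" unfolding P_def using L \<tau> mult_right_mono[of 1 L \<tau>] by simp
    then have "5 * (v - u) + 30 * \<tau> \<le> 70 * P" using uv(4) by argo
    then show "5 * 1 * ((v + 3 * \<tau>) - (u - 3 * \<tau>)) \<le> c" unfolding c P_def by simp
  qed
  finally show ?thesis using leb D by blast
qed

lemma pushforward_singular: "mutually_singular (pushforward H) circle_lebesgue"
proof -
  obtain D where D: "\<And>m. D m \<in> sets circle_lebesgue"
    "\<And>m. emeasure (pushforward H) (D m) \<le> ennreal (70 * ((\<Prod>j=1..m. K / t j) * t (Suc m)))"
    "\<And>m. emeasure circle_lebesgue (space circle_lebesgue - D m) \<le> ennreal (70 * ((\<Prod>j=1..m. K / t j) * t (Suc m)))"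
    using exists_separating_set by metis
  show ?thesis
  proof (rule mutually_singularI_summable[where D = D])
    show "summable (\<lambda>m. 70 * ((\<Prod>j=1..m. K / t j) * t (Suc m)))"
      by (rule summable_mult[OF sum])
    show "0 \<le> 70 * ((\<Prod>j=1..m. K / t j) * t (Suc m))" for m
      using Hs_lift[of m] t_bounds[of "Suc m"] by (simp add: normal_lift_def)
    show "sets (pushforward H) = sets circle_lebesgue" "D m \<in> sets (pushforward H)" for m
      using D(1) by (simp_all add: pushforward_def)
  qed (rule D)+
qed

end

text \<open>One dichotomy for \<open>c\<close> serves both cases: it is read at \<open>y\<close> if
  \<open>a n\<close> holds and at \<open>inv c y\<close> otherwise, which exchanges the two
  combs.\<close>

lemma h_map_block:
  assumes "cutoff \<psi>" "M \<ge> 0" "\<And>x y. x \<le> y \<Longrightarrow> 0 \<le> \<psi> y - \<psi> x \<and> \<psi> y - \<psi> x \<le> M * (y - x)"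
    and q: "q n > 0" and t: "0 < t_seq q n" "t_seq q n < 1/10"
  shows "normal_lift ((1 + 3 * M) / t_seq q n) (h_map \<psi> q a n)"
    and "\<bar>inv (h_map \<psi> q a n) x - x\<bar> \<le> 1 / q n"
    and "\<exists>u v u' v'. -1/2 \<le> u \<and> u \<le> v \<and> v \<le> 1 \<and> v - u \<le> 8 * t_seq q n \<and>
      -1/2 \<le> u' \<and> u' \<le> v' \<and> v' \<le> 1 \<and> v' - u' \<le> 8 * t_seq q n \<and>
      (\<forall>y. inv (h_map \<psi> q a n) y \<in> comb (q n) u v \<or> y \<in> comb (q n) u' v')"
proof -
  define s where "s = t_seq q n"
  define c where "c = cover_h \<psi> (q n) s"
  have s: "0 < s" "s < 1/10" using t by (simp_all add: s_def)
  interpret circle_block \<psi> M s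
    by unfold_locales (use assms s in auto)
  note cover = cover_h_lift[OF q, folded c_def]
  note bij = circle_homeo_bij[OF normal_lift_circle_homeo[OF cover(1)]]
  have ci: "c (inv c x) = x" for x
    using bij by (simp add: bij_is_surj surj_f_inv_f)
  have h: "h_map \<psi> q a n = (if a n then inv c else c)"
    by (simp add: h_map_def c_def s_def)
  have inv_h: "inv (h_map \<psi> q a n) = (if a n then c else inv c)"
    using inv_inv_eq[OF bij] by (simp add: h)
  show "normal_lift ((1 + 3 * M) / t_seq q n) (h_map \<psi> q a n)"
    using cover(1) normal_lift_inv[OF cover(1)] by (simp add: h s_def)
  show "\<bar>inv (h_map \<psi> q a n) x - x\<bar> \<le> 1 / q n"
    using cover(2)[of x] cover(2)[of "inv c x"] ci[of x] by (auto simp: inv_h abs_minus_commute)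
  have or: "x \<in> comb (q n) ((1 - s) / 2) ((1 + s) / 2) \<or> c x \<in> comb (q n) (- 4 * s) (4 * s)" for x
    by (rule cover(3))
  have w: "(1 + s) / 2 - (1 - s) / 2 \<le> 8 * s" "4 * s - - 4 * s \<le> 8 * s" "-1/2 \<le> (1 - s) / 2"
    "(1 - s) / 2 \<le> (1 + s) / 2" "(1 + s) / 2 \<le> 1" "-1/2 \<le> - 4 * s" "- 4 * s \<le> 4 * s" "4 * s \<le> 1"
    using s by (simp_all add: field_simps)
  show "\<exists>u v u' v'. -1/2 \<le> u \<and> u \<le> v \<and> v \<le> 1 \<and> v - u \<le> 8 * t_seq q n \<and>
      -1/2 \<le> u' \<and> u' \<le> v' \<and> v' \<le> 1 \<and> v' - u' \<le> 8 * t_seq q n \<and>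
      (\<forall>y. inv (h_map \<psi> q a n) y \<in> comb (q n) u v \<or> y \<in> comb (q n) u' v')"
  proof (cases "a n")
    case True
    have "\<forall>y. c y \<in> comb (q n) (- 4 * s) (4 * s) \<or> y \<in> comb (q n) ((1 - s) / 2) ((1 + s) / 2)"
      using or by blast
    then show ?thesis
      unfolding inv_h if_P[OF True] s_def[symmetric] using w by blast
  next
    case False
    have "\<forall>y. inv c y \<in> comb (q n) ((1 - s) / 2) ((1 + s) / 2) \<or> y \<in> comb (q n) (- 4 * s) (4 * s)"
      using or ci by metis
    then show ?thesis
      unfolding inv_h if_not_P[OF False] s_def[symmetric] using w by blast
  qed
qed

section \<open>Growth of the denominators and summability of the distortion\<close>

lemma inverse_t_seq:
  assumes "q n > 0" "n \<ge> 1"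
  shows "1 / t_seq q n = real (q n) ^ (2 * n - 1)"
proof -
  have e: "1 - 2 * int n = - int (2 * n - 1)"
    using assms(2) by (simp add: of_nat_diff)
  show ?thesis
    unfolding t_seq_def e power_int_minus power_int_of_nat by (simp add: inverse_eq_divide)
qed

text \<open>All earlier distortions together cost only the square of the next denominator. In the
  induction the exponent \<open>2 + (2 * n + 1)\<close> is at most \<open>4 * Suc n\<close>, and two
  factors \<open>x ^ (2 * Suc n)\<close> are absorbed by the square of the following
  denominator.\<close>

lemma prod_inverse_t_seq_le:
  assumes "\<And>n. n \<ge> 1 \<Longrightarrow> q n > 0" "\<And>n. n \<ge> 1 \<Longrightarrow> q (Suc n) \<ge> q n ^ (2 * n)"
  shows "(\<Prod>j=1..n. 1 / t_seq q j) \<le> real (q (Suc n)) ^ 2"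
proof (induction n)
  case 0
  have "real (q 1) \<ge> 1" using assms(1)[of 1] by simp
  then show ?case by simp
next
  case (Suc n)
  define x where "x = real (q (Suc n))"
  have x: "x \<ge> 1" using assms(1)[of "Suc n"] by (simp add: x_def)
  have "1 / t_seq q (Suc n) = x ^ (2 * n + 1)"
    using inverse_t_seq[of q "Suc n"] assms(1)[of "Suc n"] by (simp add: x_def)
  then have "(\<Prod>j=1..Suc n. 1 / t_seq q j) = (\<Prod>j=1..n. 1 / t_seq q j) * x ^ (2 * n + 1)"
    by simp
  also have "\<dots> \<le> x ^ 2 * x ^ (2 * n + 1)"
    using Suc.IH x by (intro mult_right_mono) (auto simp: x_def)
  also have "\<dots> = x ^ (2 + (2 * n + 1))"
    by (simp only: power_add)
  also have "\<dots> \<le> x ^ (2 * Suc n * 2)"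
    using x by (intro power_increasing) auto
  also have "\<dots> = (x ^ (2 * Suc n)) ^ 2"
    by (simp only: power_mult)
  also have "\<dots> \<le> real (q (Suc (Suc n))) ^ 2"
  proof (rule power_mono)
    have "real (q (Suc n) ^ (2 * Suc n)) \<le> real (q (Suc (Suc n)))"
      using assms(2)[of "Suc n"] by (simp only: of_nat_le_iff)
    then show "x ^ (2 * Suc n) \<le> real (q (Suc (Suc n)))" by (simp add: x_def)
  qed (use x in simp)
  finally show ?case .
qed

text \<open>With \<open>x = q (Suc m)\<close> a term is at most
  \<open>K ^ m * x ^ 2 / x ^ (2 * m + 1)\<close>, which is at most \<open>(K / x) ^ m\<close>; this
  is dominated by a geometric series once \<open>x \<ge> 2 * K\<close>.\<close>

lemma summable_distortion:
  fixes K :: real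
  assumes q: "\<And>n. n \<ge> 1 \<Longrightarrow> q n > 0" "\<And>n. n \<ge> 1 \<Longrightarrow> q (Suc n) \<ge> q n ^ (2 * n)"
    and growth: "\<And>n. n \<ge> 1 \<Longrightarrow> n \<le> q n" and K: "K \<ge> 1"
  shows "summable (\<lambda>m. (\<Prod>j=1..m. K / t_seq q j) * t_seq q (Suc m))"
proof -
  obtain N where N: "real N \<ge> 2 * K" using real_arch_simple by blast
  show ?thesis
  proof (rule summable_comparison_test')
    show "summable (\<lambda>m. (1/2 :: real) ^ m)" by (rule summable_geometric) simp
    \<comment> \<open>\<open>m \<ge> N\<close> yields \<open>x \<ge> 2 * K\<close>, and
      \<open>m \<ge> 1\<close> yields \<open>m + 2 \<le> 2 * m + 1\<close>.\<close>
    fix m assume m: "m \<ge> max N 1"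
    define x where "x = real (q (Suc m))"
    have x: "x \<ge> 2 * K" using growth[of "Suc m"] m N by (simp add: x_def)
    have x1: "x \<ge> 1" using x K by simp
    have tp: "t_seq q j > 0" if "j \<ge> 1" for j
      using q(1)[OF that] by (simp add: t_seq_def)
    have T: "t_seq q (Suc m) = 1 / x ^ (2 * m + 1)"
      using inverse_t_seq[of q "Suc m"] q(1)[of "Suc m"] tp[of "Suc m"] by (simp add: x_def field_simps)
    have P: "(\<Prod>j=1..m. K / t_seq q j) = K ^ m * (\<Prod>j=1..m. 1 / t_seq q j)"
      by (simp add: prod_dividef)
    have pos: "0 \<le> (\<Prod>j=1..m. 1 / t_seq q j)"
      by (intro prod_nonneg) (use tp in \<open>auto intro!: less_imp_le\<close>)
    have "(\<Prod>j=1..m. K / t_seq q j) * t_seq q (Suc m) \<le> K ^ m * x ^ 2 * (1 / x ^ (2 * m + 1))"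
      unfolding P T using K x1 prod_inverse_t_seq_le[of q m] q
      by (intro mult_right_mono mult_left_mono) (auto simp: x_def)
    also have "\<dots> \<le> K ^ m * (1 / x ^ m)"
    proof -
      have "x ^ 2 * x ^ m \<le> x ^ (2 * m + 1)"
        unfolding power_add[symmetric] using m x1 by (intro power_increasing) auto
      then have "x ^ 2 * (1 / x ^ (2 * m + 1)) \<le> 1 / x ^ m"
        using x1 by (simp add: field_simps)
      then show ?thesis
        unfolding mult.assoc using K by (intro mult_left_mono) auto
    qed
    also have "\<dots> = (K / x) ^ m" by (simp add: power_divide)
    also have "\<dots> \<le> (1/2) ^ m"
      using x x1 K by (intro power_mono) (auto simp: field_simps)
    finally show "norm ((\<Prod>j=1..m. K / t_seq q j) * t_seq q (Suc m)) \<le> (1/2) ^ m"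
      using P pos K tp[of "Suc m"] by simp
  qed
qed

theorem lemma5p2:
  fixes \<alpha> :: real and p :: "nat \<Rightarrow> int" and q :: "nat \<Rightarrow> nat"
    and \<psi> :: "real \<Rightarrow> real" and T H :: "(nat \<Rightarrow> bool) \<Rightarrow> real \<Rightarrow> real"
  assumes "Liouville \<alpha>"
    and "cutoff \<psi>"
    and "\<And>n. n \<ge> 1 \<Longrightarrow> q n > 0 \<and> t_seq q n < 1/10"
    and "\<And>n. n \<ge> 1 \<Longrightarrow>
           \<bar>\<alpha> - of_int (p (Suc n)) / real (q (Suc n))\<bar> \<le> \<bar>\<alpha> - of_int (p n) / real (q n)\<bar>"
    and "(\<lambda>n. \<bar>\<alpha> - of_int (p n) / real (q n)\<bar>) \<longlonglongrightarrow> 0"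
    and "\<And>n. n \<ge> 1 \<Longrightarrow> q (Suc n) \<ge> q n ^ (2 * n)"
    and "\<And>a. T a \<in> H_infinity \<alpha>"
    and "\<And>a. converges_Diff_infinity
           (\<lambda>n. conj_rotation (H_seq \<psi> q a n) (of_int (p (Suc n)) / real (q (Suc n)))) (T a)"
    and "\<And>a. converges_Diff_infinity (\<lambda>n. conj_rotation (H_seq \<psi> q a n) \<alpha>) (T a)"
    and "\<And>a. circle_homeo (H a)"
    and "\<And>a. converges_Ck 0 (H_seq \<psi> q a) (H a)"
  shows "\<forall>a. singular_homeo \<alpha> (H a)"
proof
  fix a
  note q = assms(3)[THEN conjunct1] and pow = assms(6)
  have tpos: "t_seq q n > 0" if "n \<ge> 1" for n
    using q[OF that] by (simp add: t_seq_def)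
  have q2: "q n \<ge> 2" if "n \<ge> 1" for n
  proof (rule ccontr)
    assume "\<not> q n \<ge> 2"
    \<comment> \<open>A denominator \<open>1\<close> would give \<open>t_seq q n = 1\<close>
      whatever the exponent.\<close>
    then have "q n = 1" using q[OF that] by linarith
    then show False using assms(3)[OF that] by (simp add: t_seq_def)
  qed
  have double: "2 * q n \<le> q (Suc n)" if "n \<ge> 1" for n
  proof -
    have "2 * q n \<le> q n ^ 2" using q2[OF that] by (simp add: power2_eq_square)
    also have "\<dots> \<le> q n ^ (2 * n)" using q2[OF that] that by (intro power_increasing) auto
    finally show ?thesis using pow[OF that] by linarith
  qed
  have growth: "n \<le> q n" if "n \<ge> 1" for n
    using that
  proof (induction n rule: dec_induct)
    case base
    then show ?case using q2[of 1] by simp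
  next
    case (step n)
    then show ?case using double[of n] q2[of n] by linarith
  qed
  have q_t: "real (q n) / q (Suc n) \<le> t_seq q n" if "n \<ge> 1" for n
  proof -
    \<comment> \<open>The exponents match exactly: \<open>q n / t_seq q n\<close> is the power
      \<open>q n ^ (2 * n)\<close> that bounds \<open>q (Suc n)\<close> from below.\<close>
    have "real (q n) * (1 / t_seq q n) = real (q n) ^ (2 * n)"
      unfolding inverse_t_seq[of q n, OF q[OF that] that] using that by (simp flip: power_Suc)
    also have "\<dots> \<le> real (q (Suc n))"
      using pow[OF that] by (metis of_nat_le_iff of_nat_power)
    finally have "real (q n) * (1 / t_seq q n) \<le> real (q (Suc n))" .
    then show ?thesis using tpos[OF that] q[of "Suc n"] by (simp add: field_simps)
  qed
  obtain M where M: "M \<ge> 0" "\<And>x y. x \<le> y \<Longrightarrow> 0 \<le> \<psi> y - \<psi> x \<and> \<psi> y - \<psi> x \<le> M * (y - x)"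
    using cutoff_lipschitz[OF assms(2)] by blast
  note block = h_map_block[OF assms(2) M q tpos assms(3)[THEN conjunct2]]
  \<comment> \<open>\<open>K = 1 + 3 * M\<close> is the same for every \<open>n\<close>, so the
    distortion product contains \<open>K\<close> only as a geometric factor.\<close>
  interpret block_composition "h_map \<psi> q a" "H_seq \<psi> q a" q "t_seq q" "1 + 3 * M" "H a"
  proof
    show "summable (\<lambda>m. (\<Prod>j=1..m. (1 + 3 * M) / t_seq q j) * t_seq q (Suc m))"
      by (rule summable_distortion) (use q pow growth M in auto)
    show "(\<lambda>n. circle_dist (inv (H_seq \<psi> q a n) y) (inv (H a) y)) \<longlonglongrightarrow> 0" for y
      by (rule converges_Ck_0_inv) (rule assms(11))
  qed (use assms(3,10) q tpos double q_t block in auto)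
  have "\<alpha> \<notin> \<rat>" using assms(1) by (simp add: Liouville_def)
  then show "singular_homeo \<alpha> (H a)"
    unfolding singular_homeo_def
    using unique_invariant_pushforward[OF _ assms(10)] pushforward_singular by blast
qed

end
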